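(* For every $p\in(0,1/2)$ and every $\epsilon>0$, two deterministic $p$-faulty agents can solve probabilistically disoriented linear search with parameter $p$ with competitive ratio $4.59112+\epsilon$ (where $4.59112\approx 1+1/W(1/e)$, $W$ the Lambert W-function), independently of the underlying communication model (wireless or face-to-face).
   Context: Two agents start at the origin of the real line and move at speed at most $1$ independently of each other (each may also slow down or halt). A hidden target is at an unknown point $x\in\mathbb{R}$ and is detected when an agent walks over it; the origin is also distinguishable. Each agent is $p$-faulty: every attempt to change direction fails independently (and independently of the other agent) with probability $p$, in which case it keeps moving in the same direction, and the agent is not informed of the outcome. Initially agents start moving in chosen directions without fault. Agents detect when they meet; a meeting agent can serve as a distinguished point for the other, and an agent moving in some direction can pick up another agent it meets so that both continue in that direction with probability $1$. In the wireless model messages are exchanged instantaneously; in the face-to-face model only when co-located. Deterministic agents have no random oracle. If $E(x)$ is the expected time at which the last agent reaches target $x$, the competitive ratio is $\limsup_{|x|\to\infty}E(x)/|x|$. *)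

theory Defs
  imports "HOL-Probability.Probability"
begin

datatype agent = Alice | Bob

fun peer :: "agent \<Rightarrow> agent" where
  "peer Alice = Bob"
| "peer Bob = Alice"

datatype direction = Leftward | Rightward

fun flip :: "direction \<Rightarrow> direction" where
  "flip Leftward = Rightward"
| "flip Rightward = Leftward"

fun orient :: "direction \<Rightarrow> real" where
  "orient Leftward = - 1"
| "orient Rightward = 1"

datatype communication = Wireless | Face_to_Face


text \<open>
  What an agent senses at an instant: the common clock, whether it stands on the origin, whether
  it stands on the target, and whether the other agent is at the same place.  Positions, headings
  and the outcomes of turn attempts are never sensed.
\<close>

record percept =
  clock :: real
  at_origin :: bool
  at_target :: bool
  together :: bool

text \<open>
  The information of an agent: its percepts so far, each with what it heard from the other agent at
  that instant.  Messages are unrestricted, so hearing the other agent is taken to be hearing all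
  that the other agent knows.  Past actions need not be recorded, since they are functions of past
  views.
\<close>

datatype view = Start | Extend view percept "view option"

text \<open>
  An action consists of a steering decision, a speed to be kept, and a delay after which the agent
  wants to act again unless something happens to it before.  By \<open>Turn\<close> the agent attempts to
  change direction; by \<open>Pick_Up\<close> it keeps its direction and takes the other agent along.
\<close>

datatype steering = Keep | Turn | Pick_Up

record action =
  steer :: steering
  pace :: real
  delay :: real

text \<open>
  A deterministic protocol: the actions are functions of the information of the agents, and the only
  randomness is that of the faults.
\<close>

record protocol =
  initial_heading :: "agent \<Rightarrow> direction"
  decide :: "agent \<Rightarrow> view \<Rightarrow> action"

definition admissible :: "protocol \<Rightarrow> bool" where
  "admissible P \<longleftrightarrow>
     (\<forall>i v. 0 \<le> pace (decide P i v) \<and> pace (decide P i v) \<le> 1 \<and> 0 < delay (decide P i v))"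


text \<open>
  The state right after the decisions taken at time \<open>now\<close>; until the next decision the agents move
  with constant velocity.  \<open>attempts i\<close> counts the turn attempts made by \<open>i\<close>.
\<close>

record state =
  now :: real
  pos :: "agent \<Rightarrow> real"
  heading :: "agent \<Rightarrow> direction"
  speed :: "agent \<Rightarrow> real"
  alarm :: "agent \<Rightarrow> real"
  attempts :: "agent \<Rightarrow> nat"
  view :: "agent \<Rightarrow> view"

definition location :: "state \<Rightarrow> real \<Rightarrow> agent \<Rightarrow> real" where
  "location st s i = pos st i + orient (heading st i) * speed st i * (s - now st)"

text \<open>
  Something happens to agent \<open>i\<close> at time \<open>s\<close>: its delay expires, it arrives at the origin or at the
  target \<open>x\<close>, or it meets the other agent.
\<close>

definition event :: "real \<Rightarrow> state \<Rightarrow> real \<Rightarrow> agent \<Rightarrow> bool" where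
  "event x st s i \<longleftrightarrow> now st < s \<and>
     (s = alarm st i \<or>
      (\<exists>y\<in>{0, x}. pos st i \<noteq> y \<and> location st s i = y) \<or>
      (pos st i \<noteq> pos st (peer i) \<and> location st s i = location st s (peer i)))"

definition next_time :: "real \<Rightarrow> state \<Rightarrow> real" where
  "next_time x st = (LEAST s. \<exists>i. event x st s i)"

definition sense :: "real \<Rightarrow> state \<Rightarrow> agent \<Rightarrow> percept" where
  "sense x st i = \<lparr>clock = now st, at_origin = (pos st i = 0), at_target = (pos st i = x),
     together = (pos st i = pos st (peer i))\<rparr>"

definition linked :: "communication \<Rightarrow> state \<Rightarrow> bool" where
  "linked c st \<longleftrightarrow> c = Wireless \<or> pos st Alice = pos st Bob"

text \<open>
  The decisions of the agents in \<open>S\<close> at time \<open>now st\<close>.  The coin \<open>\<omega> (i, k)\<close> is true iff the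
  \<open>k\<close>-th turn attempt of agent \<open>i\<close> fails.  An agent is picked up by a co-located agent that has
  been moving and does not turn; being picked up involves no coin.
\<close>

definition decisions ::
  "communication \<Rightarrow> protocol \<Rightarrow> real \<Rightarrow> (agent \<times> nat \<Rightarrow> bool) \<Rightarrow> agent set \<Rightarrow> state \<Rightarrow> state" where
  "decisions c P x \<omega> S st =
    (let heard = (\<lambda>i. if linked c st
                       then Some (Extend (view st (peer i)) (sense x st (peer i)) None) else None);
         view' = (\<lambda>i. if i \<in> S then Extend (view st i) (sense x st i) (heard i) else view st i);
         act = (\<lambda>i. decide P i (view' i));
         picked = (\<lambda>i. {i, peer i} \<subseteq> S \<and> pos st i = pos st (peer i) \<and> 0 < speed st (peer i) \<and>
                        steer (act (peer i)) = Pick_Up \<and> steer (act i) = Keep);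
         turns = (\<lambda>i. i \<in> S \<and> steer (act i) = Turn)
     in st\<lparr>heading := (\<lambda>i. if picked i then heading st (peer i)
                            else if turns i \<and> \<not> \<omega> (i, attempts st i) then flip (heading st i)
                            else heading st i),
           speed := (\<lambda>i. if i \<in> S then pace (act i) else speed st i),
           alarm := (\<lambda>i. if i \<in> S then now st + delay (act i) else alarm st i),
           attempts := (\<lambda>i. if turns i then Suc (attempts st i) else attempts st i),
           view := view'\<rparr>)"

text \<open>
  An agent acts when something happens to it or when it is contacted by the other agent, to which
  something happens.
\<close>

definition step ::
  "communication \<Rightarrow> protocol \<Rightarrow> real \<Rightarrow> (agent \<times> nat \<Rightarrow> bool) \<Rightarrow> state \<Rightarrow> state" where
  "step c P x \<omega> st =
    (let s = next_time x st;
         st' = st\<lparr>now := s, pos := location st s\<rparr>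
     in decisions c P x \<omega> {i. event x st s i \<or> linked c st' \<and> event x st s (peer i)} st')"

definition initial_state :: "protocol \<Rightarrow> state" where
  "initial_state P = \<lparr>now = 0, pos = (\<lambda>_. 0), heading = initial_heading P, speed = (\<lambda>_. 0),
     alarm = (\<lambda>_. 0), attempts = (\<lambda>_. 0), view = (\<lambda>_. Start)\<rparr>"

primrec run ::
  "communication \<Rightarrow> protocol \<Rightarrow> real \<Rightarrow> (agent \<times> nat \<Rightarrow> bool) \<Rightarrow> nat \<Rightarrow> state" where
  "run c P x \<omega> 0 = decisions c P x \<omega> UNIV (initial_state P)"
| "run c P x \<omega> (Suc n) = step c P x \<omega> (run c P x \<omega> n)"

text \<open>
  Arriving at the target is an event, so the first visit of the target is one of the decision times.
  The infimum of the empty set is \<open>\<infinity>\<close>; this covers an agent that never reaches the target (nothing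
  is credited beyond an accumulation point of decision times).
\<close>

definition reach_time ::
  "communication \<Rightarrow> protocol \<Rightarrow> real \<Rightarrow> (agent \<times> nat \<Rightarrow> bool) \<Rightarrow> agent \<Rightarrow> ennreal" where
  "reach_time c P x \<omega> i =
     (INF n\<in>{n. pos (run c P x \<omega> n) i = x}. ennreal (now (run c P x \<omega> n)))"

definition search_time ::
  "communication \<Rightarrow> protocol \<Rightarrow> real \<Rightarrow> (agent \<times> nat \<Rightarrow> bool) \<Rightarrow> ennreal" where
  "search_time c P x \<omega> = max (reach_time c P x \<omega> Alice) (reach_time c P x \<omega> Bob)"

definition faults :: "real \<Rightarrow> (agent \<times> nat \<Rightarrow> bool) measure" where
  "faults p = (\<Pi>\<^sub>M _\<in>UNIV. measure_pmf (bernoulli_pmf p))"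

text \<open>
  For every \<open>n\<close> the state \<open>run c P x \<omega> n\<close> depends on finitely many coins only, so \<open>search_time\<close> is a
  measurable function of \<open>\<omega>\<close> and the integral below is its expectation.
\<close>

definition expected_time :: "communication \<Rightarrow> real \<Rightarrow> protocol \<Rightarrow> real \<Rightarrow> ennreal" where
  "expected_time c p P x = (\<integral>\<^sup>+ \<omega>. search_time c P x \<omega> \<partial>faults p)"

definition solves_search :: "communication \<Rightarrow> real \<Rightarrow> protocol \<Rightarrow> bool" where
  "solves_search c p P \<longleftrightarrow>
     admissible P \<and> (\<forall>x. AE \<omega> in faults p. search_time c P x \<omega> < \<infinity>)"

definition competitive_ratio :: "communication \<Rightarrow> real \<Rightarrow> protocol \<Rightarrow> ennreal" where
  "competitive_ratio c p P =
     Limsup at_infinity (\<lambda>x::real. expected_time c p P x / ennreal \<bar>x\<bar>)"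


text \<open>The principal branch of the Lambert W-function, for \<open>y \<ge> - exp (- 1)\<close>.\<close>

definition Lambert_W :: "real \<Rightarrow> real" where
  "Lambert_W y = (THE w. - 1 \<le> w \<and> w * exp w = y)"

end

theory Submission
  imports Defs
begin

text \<open>
  Two faulty agents imitate a single agent that turns reliably and tosses coins.  They march
  together, Alice running slightly ahead of Bob.  To turn, Bob halts and Alice attempts to turn; if
  she succeeds, she is back at Bob after a time known in advance, and takes him along.  If she is not
  back by then, the attempt failed and her distance to Bob has doubled; she tries again.  As
  \<open>2 * p < 1\<close>, the expected time lost in this way is finite, and it is bounded uniformly in the
  target when the initial gaps between the agents decrease geometrically.

  Every attempt shows both agents the outcome of a coin of bias \<open>p\<close>.  The first \<open>M\<close> outcomes,
  obtained near the origin, select an almost uniformly distributed index \<open>u < N\<close>, after which the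
  turning points are \<open>(-1)^j * q^u * r^j\<close> with \<open>q = r powr (2 / N)\<close>.  This is the optimal randomized
  search with \<open>u\<close> in the role of the random phase: the turning distances on one side of the origin
  are \<open>q^(u + N * i)\<close>, up to the factor \<open>r\<close> on the other side, so for a given target the first ones
  beyond it form, as \<open>u\<close> varies, a full geometric progression of ratio \<open>q\<close> and length \<open>N\<close>.  The
  competitive ratio tends to \<open>1 + (r + 1) / ln r\<close>, which is minimal, with value \<open>1 + r\<close>, for
  \<open>r = 1 / W(1 / e)\<close>.
\<close>

section \<open>The protocol\<close>

text \<open>
  A list records the outcomes of Alice's attempts, the most recent one first; \<open>True\<close> is a failure.
  \<open>reach l\<close> is the distance between the agents when the attempt following \<open>l\<close> is made, and also the
  time it takes to learn its outcome.
\<close>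

definition gap :: "bool list \<Rightarrow> real" where
  "gap l = (1 / 2) ^ length l"

fun reach :: "bool list \<Rightarrow> real" where
  "reach (True # l) = 2 * reach l"
| "reach l = gap l"

text \<open>A failed attempt is followed at once by the next one; only a success, or the very
  beginning, is followed by a march.\<close>

fun marches :: "bool list \<Rightarrow> bool" where
  "marches (True # l) \<longleftrightarrow> False"
| "marches l \<longleftrightarrow> True"

fun successes :: "bool list \<Rightarrow> nat" where
  "successes [] = 0"
| "successes (b # l) = (if b then successes l else Suc (successes l))"

definition course :: "bool list \<Rightarrow> direction" where
  "course l = (if even (successes l) then Rightward else Leftward)"

text \<open>
  The mode is common knowledge: it changes only at the time \<open>due\<close>, known to both agents, according
  to whether they are together then.  Decisions forced upon an agent at other times (by a visit of
  the origin or the target, or by a message) repeat the current motion.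
\<close>

datatype mode = Begin | March (due: real) "bool list" | Probe (due: real) "bool list"

fun update :: "(bool list \<Rightarrow> real) \<Rightarrow> mode \<Rightarrow> percept \<Rightarrow> mode" where
  "update leg Begin q = March (clock q + leg [] + gap []) []"
| "update leg (March s l) q =
     (if clock q < s then March s l else Probe (clock q + reach l) l)"
| "update leg (Probe s l) q =
     (if clock q < s then Probe s l
      else if together q then March (clock q + leg (False # l) + gap (False # l)) (False # l)
      else Probe (clock q + reach (True # l)) (True # l))"

primrec memory :: "(bool list \<Rightarrow> real) \<Rightarrow> view \<Rightarrow> mode" where
  "memory leg Start = Begin"
| "memory leg (Extend v q h) = update leg (memory leg v) q"

text \<open>Bob's speed in a march lets him cover \<open>leg l\<close> in the time
  \<open>leg l + gap l\<close>, so that Alice ends exactly \<open>gap l\<close> ahead of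
  him.\<close>

fun velocity :: "(bool list \<Rightarrow> real) \<Rightarrow> mode \<Rightarrow> agent \<Rightarrow> real" where
  "velocity leg Begin i = 0"
| "velocity leg (March s l) i = (if i = Alice then 1 else leg l / (leg l + gap l))"
| "velocity leg (Probe s l) i = (if i = Alice then 1 else 0)"

text \<open>An unchanged mode identifies a decision forced before \<open>due\<close>. Bob always
  keeps his direction, which is what allows Alice to pick him up. The delay 1 is a default that
  makes delays positive on arbitrary views.\<close>

definition react :: "(bool list \<Rightarrow> real) \<Rightarrow> agent \<Rightarrow> mode \<Rightarrow> percept \<Rightarrow> action" where
  "react leg i m q =
     (let m' = update leg m q
      in \<lparr>steer = (if i = Bob \<or> m' = m then Keep
                    else case m' of Probe _ _ \<Rightarrow> Turn | _ \<Rightarrow> Pick_Up),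
          pace = velocity leg m' i,
          delay = (if clock q < due m' then due m' - clock q else 1)\<rparr>)"

definition search_protocol :: "(bool list \<Rightarrow> real) \<Rightarrow> protocol" where
  "search_protocol leg =
     \<lparr>initial_heading = (\<lambda>_. Rightward),
      decide = (\<lambda>i v. case v of
          Start \<Rightarrow> \<lparr>steer = Keep, pace = 0, delay = 1\<rparr>
        | Extend v q h \<Rightarrow> react leg i (memory leg v) q)\<rparr>"

lemma gap_pos: "0 < gap l"
  by (simp add: gap_def)

lemma reach_pos: "0 < reach l"
  by (induction l rule: reach.induct) (auto simp: gap_pos)

lemma reach_marches: "marches l \<Longrightarrow> reach l = gap l"
  by (cases l rule: marches.cases) auto

lemma agent_all: "(\<forall>i. P i) \<longleftrightarrow> P Alice \<and> P Bob"
  by (metis agent.exhaust)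

lemma agent_ex: "(\<exists>i. P i) \<longleftrightarrow> P Alice \<or> P Bob"
  by (metis agent.exhaust)

lemma orient_flip [simp]: "orient (flip d) = - orient d"
  by (cases d) auto

lemma orient_nonzero [simp]: "orient d \<noteq> 0"
  by (cases d) auto

lemma admissible_search_protocol:
  assumes "\<And>l. 0 < leg l"
  shows "admissible (search_protocol leg)"
proof -
  have "0 \<le> velocity leg m i \<and> velocity leg m i \<le> 1" for m i
    using assms gap_pos by (cases m) (auto simp: field_simps add_pos_pos less_imp_le)
  then show ?thesis
    by (auto simp: admissible_def search_protocol_def react_def Let_def split: view.split)
qed

section \<open>Executions\<close>

lemma finite_affine_zeros:
  fixes a b :: real
  assumes "b \<noteq> 0 \<or> a \<noteq> 0"
  shows "finite {s. a + b * (s - t) = 0}"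
proof (cases "b = 0")
  case False
  have "{s. a + b * (s - t) = 0} \<subseteq> {t - a / b}"
    using False by (auto simp: field_simps)
  then show ?thesis
    by (rule finite_subset) simp
qed (use assms in auto)

text \<open>Arrivals and meetings are zeros of affine functions of time, and the demand that the
  present positions differ excludes functions vanishing identically.\<close>

lemma finite_events: "finite {s. \<exists>i. event x st s i}"
proof -
  let ?hit = "\<lambda>i y. {s. pos st i \<noteq> y \<and> location st s i = y}"
  let ?meet = "\<lambda>i. {s. pos st i \<noteq> pos st (peer i) \<and> location st s i = location st s (peer i)}"
  have hit: "finite (?hit i y)" for i y
  proof (cases "pos st i = y")
    case False
    have "{s. location st s i = y} =
        {s. (pos st i - y) + (orient (heading st i) * speed st i) * (s - now st) = 0}"
      by (auto simp: location_def)
    then show ?thesis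
      using False finite_affine_zeros[of _ "pos st i - y"] by auto
  qed simp
  have meet: "finite (?meet i)" for i
  proof (cases "pos st i = pos st (peer i)")
    case False
    have "{s. location st s i = location st s (peer i)} =
        {s. (pos st i - pos st (peer i)) +
          (orient (heading st i) * speed st i - orient (heading st (peer i)) * speed st (peer i)) *
          (s - now st) = 0}"
      by (auto simp: location_def algebra_simps)
    then show ?thesis
      using False finite_affine_zeros[of _ "pos st i - pos st (peer i)"] by auto
  qed simp
  have "{s. \<exists>i. event x st s i} \<subseteq>
      (\<Union>i\<in>{Alice, Bob}. {alarm st i} \<union> ?hit i 0 \<union> ?hit i x \<union> ?meet i)"
    unfolding event_def agent_ex by auto
  then show ?thesis
    by (rule finite_subset) (use hit meet[of Alice] meet[of Bob] in auto)
qed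

text \<open>On the reals \<open>LEAST\<close> need not exist; finiteness of the set of event times
  turns it into a minimum.\<close>

lemma next_time_properties:
  assumes "event x st s i"
  shows "now st < next_time x st" "next_time x st \<le> s" "\<exists>j. event x st (next_time x st) j"
proof -
  let ?E = "{s. \<exists>i. event x st s i}"
  have ne: "?E \<noteq> {}" using assms by auto
  have min: "Min ?E \<in> ?E" using Min_in[OF finite_events ne] .
  have eq: "next_time x st = Min ?E"
    unfolding next_time_def
  proof (rule Least_equality)
    show "\<exists>i. event x st (Min ?E) i" using min by simp
  next
    fix s assume "\<exists>i. event x st s i"
    then have "s \<in> ?E" by simp
    then show "Min ?E \<le> s" by (rule Min_le[OF finite_events])
  qed
  show "\<exists>j. event x st (next_time x st) j" using min eq by simp
  then show "now st < next_time x st" by (auto simp: event_def)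
  show "next_time x st \<le> s" unfolding eq using assms by (intro Min_le finite_events) auto
qed

section \<open>Motion within one phase of constant mode\<close>

text \<open>The invariant of a phase that began at time \<open>t\<close> at positions
  \<open>y\<close>. Positions are computed from \<open>t\<close> and not from the last decision, so
  that forced decisions preserve it.\<close>

definition phase ::
  "(bool list \<Rightarrow> real) \<Rightarrow> mode \<Rightarrow> nat \<Rightarrow> real \<Rightarrow> (agent \<Rightarrow> real) \<Rightarrow> (agent \<Rightarrow> direction) \<Rightarrow> state \<Rightarrow> bool"
  where
  "phase leg m k t y d st \<longleftrightarrow> m \<noteq> Begin \<and> t \<le> now st \<and> now st < due m \<and> attempts st Alice = k \<and>
     (\<forall>i. memory leg (view st i) = m \<and> alarm st i = due m \<and> heading st i = d i \<and>
          speed st i = velocity leg m i \<and>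
          pos st i = y i + orient (d i) * velocity leg m i * (now st - t))"

lemma phase_location:
  "phase leg m k t y d st \<Longrightarrow> location st s i = y i + orient (d i) * velocity leg m i * (s - t)"
  by (simp add: phase_def location_def algebra_simps)

lemma now_pos_decisions [simp]:
  "now (decisions c P x \<omega> S st) = now st" "pos (decisions c P x \<omega> S st) = pos st"
  by (simp_all add: decisions_def Let_def)

lemma now_pos_step [simp]:
  "now (step c P x \<omega> st) = next_time x st"
  "pos (step c P x \<omega> st) = location st (next_time x st)"
  by (simp_all add: step_def Let_def)

lemma update_before_due: "m \<noteq> Begin \<Longrightarrow> clock q < due m \<Longrightarrow> update leg m q = m"
  by (cases m) auto

text \<open>Each deciding agent recomputes the same mode, repeats its motion and resets its alarm to
  the same instant \<open>due m\<close>.\<close>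

lemma phase_step_before_due:
  assumes ph: "phase leg m k t y d st" and "next_time x st < due m" "now st < next_time x st"
  shows "phase leg m k t y d (step c (search_protocol leg) x \<omega> st)"
proof -
  let ?st = "st\<lparr>now := next_time x st, pos := location st (next_time x st)\<rparr>"
  have upd: "update leg m (sense x ?st i) = m" for i
    using ph assms(2) by (intro update_before_due) (auto simp: phase_def sense_def)
  have mem: "memory leg (view st i) = m" for i
    using ph by (simp add: phase_def)
  have clk: "clock (sense x ?st i) = next_time x st" for i
    by (simp add: sense_def)
  note loc = phase_location[OF ph]
  show ?thesis
    unfolding phase_def
    using ph assms upd mem
    by (auto simp: step_def decisions_def Let_def search_protocol_def react_def phase_def loc clk)
qed

text \<open>A forced decision does not alter the trajectories, so it creates no new event.\<close>

lemma event_step_before_due: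
  assumes ph: "phase leg m k t y d st" and "next_time x st < due m" "now st < next_time x st"
    and ev: "event x (step c (search_protocol leg) x \<omega> st) s i"
  shows "event x st s i"
proof -
  let ?st = "step c (search_protocol leg) x \<omega> st"
  have ph': "phase leg m k t y d ?st"
    by (rule phase_step_before_due[OF assms(1-3)])
  have loc: "location ?st s i = location st s i" for s i
    using phase_location[OF ph] phase_location[OF ph'] by simp
  have pos: "pos st i = location st (now st) i" "pos ?st i = location st (now ?st) i" for i
    by (simp_all add: location_def)
  have s: "now st < s" "now ?st < s" "now st < now ?st"
    using ev assms(3) by (auto simp: event_def)
  \<comment> \<open>An affine motion with the same value at two instants is constant. Hence an agent
    off a point now and on it at \<open>s\<close> was off it at the earlier decision too;
    \<open>const2\<close> is the analogue for the difference of two motions.\<close>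
  have const: "location st (now ?st) i = z" 
    if "location st (now st) i = z" "location st s i = z" for i z
    using that s by (auto simp: location_def)
  have const2: "location st (now ?st) i = location st (now ?st) j" 
    if "location st (now st) i = location st (now st) j" "location st s i = location st s j" for i j
  proof -
    have "(orient (heading st i) * speed st i - orient (heading st j) * speed st j) * (s - now st) = 0"
      using that by (simp add: location_def algebra_simps)
    then have "orient (heading st i) * speed st i = orient (heading st j) * speed st j"
      using s by simp
    then show ?thesis
      using that by (simp add: location_def)
  qed
  have alarm: "alarm ?st i = alarm st i"
    using ph ph' by (simp add: phase_def)
  show ?thesis
    using ev s unfolding event_def loc pos alarm
    using const const2 by metis
qed

text \<open>Every forced step uses up its event and adds none, so the number of pending events
  decreases until the event at \<open>\<tau>\<close> is the next one.\<close>

lemma phase_progress: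
  assumes "phase leg m k t y d (run c (search_protocol leg) x \<omega> n)"
    and "now (run c (search_protocol leg) x \<omega> n) < \<tau>" and "\<tau> \<le> due m"
    and "\<And>st. phase leg m k t y d st \<Longrightarrow> now st < \<tau> \<Longrightarrow> \<exists>i. event x st \<tau> i"
  shows "\<exists>n'. phase leg m k t y d (run c (search_protocol leg) x \<omega> n') \<and>
      next_time x (run c (search_protocol leg) x \<omega> n') = \<tau>"
  using assms(1,2)
proof (induction "card {s. \<exists>i. event x (run c (search_protocol leg) x \<omega> n) s i}" arbitrary: n
    rule: less_induct)
  case less
  let ?st = "run c (search_protocol leg) x \<omega> n"
  obtain i where i: "event x ?st \<tau> i"
    using assms(4)[OF less.prems] by blast
  note nt = next_time_properties[OF i]
  show ?case
  proof (cases "next_time x ?st = \<tau>")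
    case True
    then show ?thesis using less.prems by blast
  next
    case False
    then have lt: "next_time x ?st < \<tau>" using nt by simp
    let ?st' = "run c (search_protocol leg) x \<omega> (Suc n)"
    have before: "next_time x ?st < due m" using lt assms(3) by simp
    have ph': "phase leg m k t y d ?st'"
      using phase_step_before_due[OF less.prems(1) before nt(1)] by simp
    have "{s. \<exists>i. event x ?st' s i} \<subseteq> {s. \<exists>i. event x ?st s i}"
      using event_step_before_due[OF less.prems(1) before nt(1)] unfolding run.simps by blast
    moreover have "next_time x ?st \<notin> {s. \<exists>i. event x ?st' s i}"
      by (auto simp: event_def)
    ultimately have "{s. \<exists>i. event x ?st' s i} \<subset> {s. \<exists>i. event x ?st s i}"
      using nt(3) by blast
    then have "card {s. \<exists>i. event x ?st' s i} < card {s. \<exists>i. event x ?st s i}"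
      by (rule psubset_card_mono[OF finite_events])
    from less.hyps[OF this ph'] lt show ?thesis by simp
  qed
qed

lemma phase_reaches_due:
  assumes "phase leg m k t y d (run c (search_protocol leg) x \<omega> n)"
  shows "\<exists>n'. phase leg m k t y d (run c (search_protocol leg) x \<omega> n') \<and>
      next_time x (run c (search_protocol leg) x \<omega> n') = due m"
  by (rule phase_progress[OF assms]) (use assms in \<open>auto simp: phase_def event_def\<close>)

lemma phase_visits:
  assumes ph: "phase leg m k t y d (run c (search_protocol leg) x \<omega> n)"
    and start: "now (run c (search_protocol leg) x \<omega> n) = t"
    and "t \<le> \<tau>" "\<tau> \<le> due m" and v: "velocity leg m i \<noteq> 0"
    and hit: "y i + orient (d i) * velocity leg m i * (\<tau> - t) = x"
  shows "reach_time c (search_protocol leg) x \<omega> i \<le> ennreal \<tau>"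
proof -
  have "\<exists>n'. now (run c (search_protocol leg) x \<omega> n') = \<tau> \<and> pos (run c (search_protocol leg) x \<omega> n') i = x"
  proof (cases "\<tau> = t")
    \<comment> \<open>An agent that already stands on the target has no arrival event; state
      \<open>n\<close> itself is the witness.\<close>
    case True
    then show ?thesis using ph start hit by (intro exI[of _ n]) (auto simp: phase_def)
  next
    case False
    have "\<exists>i. event x st \<tau> i" if st: "phase leg m k t y d st" "now st < \<tau>" for st
    proof -
      have "location st \<tau> i = x" using phase_location[OF st(1)] hit by simp
      moreover have "pos st i \<noteq> x"
      proof
        assume "pos st i = x"
        moreover have "pos st i = y i + orient (d i) * velocity leg m i * (now st - t)"
          using st(1) by (simp add: phase_def)
        ultimately have "orient (d i) * velocity leg m i * (now st - t) =
            orient (d i) * velocity leg m i * (\<tau> - t)"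
          using hit by linarith
        then show False using v st(2) by simp
      qed
      ultimately show ?thesis using st(2) unfolding event_def by blast
    qed
    then obtain n' where n': "phase leg m k t y d (run c (search_protocol leg) x \<omega> n')"
        "next_time x (run c (search_protocol leg) x \<omega> n') = \<tau>"
      using phase_progress[OF ph] False assms(3,4) start by (metis order_le_less)
    show ?thesis
      using n' phase_location[OF n'(1)] hit by (intro exI[of _ "Suc n'"]) auto
  qed
  then show ?thesis
    unfolding reach_time_def by (auto intro: INF_lower2)
qed

section \<open>Transitions between phases\<close>

definition arrival ::
  "(bool list \<Rightarrow> real) \<Rightarrow> mode \<Rightarrow> real \<Rightarrow> (agent \<Rightarrow> real) \<Rightarrow> (agent \<Rightarrow> direction) \<Rightarrow> agent \<Rightarrow> real"
  where
  "arrival leg m t y d i = y i + orient (d i) * velocity leg m i * (due m - t)"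

text \<open>Both alarms expire at \<open>due m\<close>, so both agents decide there in either
  communication model.\<close>

lemma step_at_due:
  assumes ph: "phase leg m k t y d st" and nt: "next_time x st = due m"
  shows "step c P x \<omega> st =
    decisions c P x \<omega> UNIV (st\<lparr>now := due m, pos := arrival leg m t y d\<rparr>)"
proof -
  have "event x st (due m) i" for i
    using ph by (auto simp: event_def phase_def)
  moreover have "location st (due m) = arrival leg m t y d"
    using phase_location[OF ph] by (auto simp: arrival_def)
  ultimately show ?thesis
    by (simp add: step_def Let_def nt)
qed

text \<open>Both agents perceive the same clock and agree on whether they are together, so their
  memories stay equal. Only Alice's coin \<open>k\<close> matters.\<close>

lemma phase_step_to_probe:
  assumes ph: "phase leg m k t y d st" and nt: "next_time x st = due m"
    and upd: "\<And>q. clock q = due m \<Longrightarrow>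
        together q = (arrival leg m t y d Alice = arrival leg m t y d Bob) \<Longrightarrow> update leg m q = Probe s l"
    and s: "due m < s"
  shows "phase leg (Probe s l) (Suc k) (due m) (arrival leg m t y d)
      (\<lambda>i. if i = Alice \<and> \<not> \<omega> (Alice, k) then flip (d i) else d i)
      (step c (search_protocol leg) x \<omega> st)"
proof -
  let ?st = "st\<lparr>now := due m, pos := arrival leg m t y d\<rparr>"
  have u: "update leg m (sense x ?st i) = Probe s l" for i
    by (rule upd) (cases i; auto simp: sense_def)+
  have clk: "clock (sense x ?st i) = due m" for i
    by (simp add: sense_def)
  have m: "Probe s l \<noteq> m"
    using s by auto
  have mem: "memory leg (view st i) = m" "heading st i = d i" "attempts st Alice = k" for i
    using ph by (auto simp: phase_def)
  show ?thesis
    unfolding step_at_due[OF ph nt] phase_def agent_all using s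
    by (auto simp: decisions_def Let_def search_protocol_def react_def u clk m mem)
qed

text \<open>Bob is picked up and takes over Alice's heading without a coin. The model lets only a
  moving agent carry the other, hence the assumption on Alice's velocity.\<close>

lemma phase_step_to_march:
  assumes ph: "phase leg m k t y d st" and nt: "next_time x st = due m"
    and meet: "arrival leg m t y d Alice = arrival leg m t y d Bob" and v: "0 < velocity leg m Alice"
    and upd: "\<And>q. clock q = due m \<Longrightarrow> together q \<Longrightarrow> update leg m q = March s l"
    and s: "due m < s"
  shows "phase leg (March s l) k (due m) (arrival leg m t y d) (\<lambda>_. d Alice)
      (step c (search_protocol leg) x \<omega> st)"
proof -
  let ?st = "st\<lparr>now := due m, pos := arrival leg m t y d\<rparr>"
  have u: "update leg m (sense x ?st i) = March s l" for i
    by (rule upd) (cases i; auto simp: sense_def meet)+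
  have clk: "clock (sense x ?st i) = due m" for i
    by (simp add: sense_def)
  have m: "March s l \<noteq> m"
    using s by auto
  have mem: "memory leg (view st i) = m" "heading st i = d i" "attempts st Alice = k"
    "speed st i = velocity leg m i" for i
    using ph by (auto simp: phase_def)
  show ?thesis
    unfolding step_at_due[OF ph nt] phase_def agent_all using s v
    by (auto simp: decisions_def Let_def search_protocol_def react_def u clk m mem meet)
qed

section \<open>The run as a function of Alice's coins\<close>

fun history :: "(agent \<times> nat \<Rightarrow> bool) \<Rightarrow> nat \<Rightarrow> bool list" where
  "history \<omega> 0 = []"
| "history \<omega> (Suc n) = \<omega> (Alice, n) # history \<omega> n"

lemma length_history [simp]: "length (history \<omega> n) = n"
  by (induction n) auto

text \<open>
  \<open>launch leg l\<close> is the time at which the outcomes in \<open>l\<close> become known, and \<open>site leg l\<close> is the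
  position of Bob at that time.
\<close>

fun launch :: "(bool list \<Rightarrow> real) \<Rightarrow> bool list \<Rightarrow> real" where
  "launch leg [] = 0"
| "launch leg (b # l) = launch leg l + (if marches l then leg l + gap l else 0) + reach l"

fun site :: "(bool list \<Rightarrow> real) \<Rightarrow> bool list \<Rightarrow> real" where
  "site leg [] = 0"
| "site leg (b # l) = site leg l + (if marches l then orient (course l) * leg l else 0)"

text \<open>The exact time is included because \<open>phase_visits\<close> needs a state at the very
  start of the phase.\<close>

definition marching where
  "marching c leg x \<omega> n N \<longleftrightarrow> (let l = history \<omega> n; st = run c (search_protocol leg) x \<omega> N in
     phase leg (March (launch leg l + leg l + gap l) l) n (launch leg l) (\<lambda>_. site leg l)
       (\<lambda>_. course l) st \<and> now st = launch leg l)"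

text \<open>The outcome of the attempt is known at \<open>s\<close>. The attempt was made
  \<open>reach l\<close> earlier, so the counter is already \<open>Suc n\<close>, and any march
  before it is over, so Bob stands at the site of the longer history.\<close>

definition probing where
  "probing c leg x \<omega> n N \<longleftrightarrow> (let l = history \<omega> n; st = run c (search_protocol leg) x \<omega> N;
      s = launch leg (history \<omega> (Suc n)) in
     phase leg (Probe s l) (Suc n) (s - reach l)
       (\<lambda>i. site leg (history \<omega> (Suc n)) + (if i = Alice then orient (course l) * reach l else 0))
       (\<lambda>i. if i = Alice \<and> \<not> \<omega> (Alice, n) then flip (course l) else course l) st)"

context
  fixes leg :: "bool list \<Rightarrow> real"
  assumes leg: "\<And>l. 0 < leg l"
begin

lemma marching_0: "marching c leg x \<omega> 0 0"
  using leg[of "[]"] gap_pos[of "[]"]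
  by (auto simp: marching_def phase_def decisions_def initial_state_def search_protocol_def
      react_def Let_def sense_def course_def)

lemma marching_imp_probing:
  assumes "marching c leg x \<omega> n N" and mar: "marches (history \<omega> n)"
  shows "\<exists>N. probing c leg x \<omega> n N"
proof -
  let ?l = "history \<omega> n"
  let ?s = "launch leg ?l + leg ?l + gap ?l"
  let ?y = "\<lambda>_::agent. site leg ?l" and ?d = "\<lambda>_::agent. course ?l"
  obtain N' where N': "phase leg (March ?s ?l) n (launch leg ?l) ?y ?d
        (run c (search_protocol leg) x \<omega> N')"
      "next_time x (run c (search_protocol leg) x \<omega> N') = due (March ?s ?l)"
    using assms(1) phase_reaches_due unfolding marching_def Let_def by blast
  have "leg ?l + gap ?l > 0" using leg gap_pos by (simp add: add_pos_pos)
  then have arr: "arrival leg (March ?s ?l) (launch leg ?l) ?y ?d =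
      (\<lambda>i. site leg (history \<omega> (Suc n)) + (if i = Alice then orient (course ?l) * reach ?l else 0))"
    using mar by (simp add: fun_eq_iff agent_all arrival_def reach_marches add.assoc)
      (simp add: distrib_left)
  have "phase leg (Probe (?s + reach ?l) ?l) (Suc n) (due (March ?s ?l))
      (arrival leg (March ?s ?l) (launch leg ?l) ?y ?d)
      (\<lambda>i. if i = Alice \<and> \<not> \<omega> (Alice, n) then flip (?d i) else ?d i)
      (step c (search_protocol leg) x \<omega> (run c (search_protocol leg) x \<omega> N'))"
    by (rule phase_step_to_probe[OF N']) (auto simp: reach_pos)
  then have "probing c leg x \<omega> n (Suc N')"
    unfolding probing_def Let_def arr using mar by (simp add: add.assoc)
  then show ?thesis ..
qed

text \<open>A failure doubles the distance, so the agents are apart when the phase ends and a new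
  attempt follows; a success brings Alice back to Bob exactly then.\<close>

lemma probing_step:
  assumes "probing c leg x \<omega> n N"
  shows "\<exists>N. if \<omega> (Alice, n) then probing c leg x \<omega> (Suc n) N else marching c leg x \<omega> (Suc n) N"
proof -
  let ?l = "history \<omega> n" and ?l' = "history \<omega> (Suc n)"
  let ?s = "launch leg ?l'"
  let ?y = "\<lambda>i. site leg ?l' + (if i = Alice then orient (course ?l) * reach ?l else 0)"
  let ?d = "\<lambda>i. if i = Alice \<and> \<not> \<omega> (Alice, n) then flip (course ?l) else course ?l"
  obtain N' where N': "phase leg (Probe ?s ?l) (Suc n) (?s - reach ?l) ?y ?d
        (run c (search_protocol leg) x \<omega> N')"
      "next_time x (run c (search_protocol leg) x \<omega> N') = due (Probe ?s ?l)"
    using assms(1) phase_reaches_due unfolding probing_def Let_def by blast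
  show ?thesis
  proof (cases "\<omega> (Alice, n)")
    case True
    have arr: "arrival leg (Probe ?s ?l) (?s - reach ?l) ?y ?d =
        (\<lambda>i. site leg (history \<omega> (Suc (Suc n))) +
          (if i = Alice then orient (course ?l') * reach ?l' else 0))"
      using True by (auto simp: arrival_def course_def)
    have "phase leg (Probe (?s + reach ?l') ?l') (Suc (Suc n)) (due (Probe ?s ?l))
        (arrival leg (Probe ?s ?l) (?s - reach ?l) ?y ?d)
        (\<lambda>i. if i = Alice \<and> \<not> \<omega> (Alice, Suc n) then flip (?d i) else ?d i)
        (step c (search_protocol leg) x \<omega> (run c (search_protocol leg) x \<omega> N'))"
    proof (rule phase_step_to_probe[OF N'])
      show "due (Probe ?s ?l) < ?s + reach ?l'"
        by (simp add: reach_pos)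
      have "arrival leg (Probe ?s ?l) (?s - reach ?l) ?y ?d Alice \<noteq>
          arrival leg (Probe ?s ?l) (?s - reach ?l) ?y ?d Bob"
        unfolding arr using reach_pos[of ?l'] by simp
      then show "update leg (Probe ?s ?l) q = Probe (?s + reach ?l') ?l'"
        if "clock q = due (Probe ?s ?l)" "together q =
          (arrival leg (Probe ?s ?l) (?s - reach ?l) ?y ?d Alice =
           arrival leg (Probe ?s ?l) (?s - reach ?l) ?y ?d Bob)" for q
        using that True by (simp del: launch.simps)
    qed
    moreover have "(\<lambda>i. if i = Alice \<and> \<not> \<omega> (Alice, Suc n) then flip (?d i) else ?d i) =
        (\<lambda>i. if i = Alice \<and> \<not> \<omega> (Alice, Suc n) then flip (course ?l') else course ?l')"
      using True by (auto simp: course_def)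
    moreover have "launch leg (history \<omega> (Suc (Suc n))) = ?s + reach ?l'"
      using True by simp
    ultimately have "probing c leg x \<omega> (Suc n) (Suc N')"
      unfolding probing_def Let_def arr by (simp del: launch.simps history.simps)
    then show ?thesis using True by auto
  next
    case False
    have arr: "arrival leg (Probe ?s ?l) (?s - reach ?l) ?y ?d = (\<lambda>_. site leg ?l')"
      using False by (auto simp: arrival_def)
    have meet: "arrival leg (Probe ?s ?l) (?s - reach ?l) ?y ?d Alice =
        arrival leg (Probe ?s ?l) (?s - reach ?l) ?y ?d Bob"
      unfolding arr ..
    have "phase leg (March (?s + leg ?l' + gap ?l') ?l') (Suc n) (due (Probe ?s ?l))
        (arrival leg (Probe ?s ?l) (?s - reach ?l) ?y ?d) (\<lambda>_. ?d Alice)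
        (step c (search_protocol leg) x \<omega> (run c (search_protocol leg) x \<omega> N'))"
      by (rule phase_step_to_march[OF N' meet])
        (use False leg[of ?l'] gap_pos[of ?l'] in auto)
    moreover have "(\<lambda>_::agent. ?d Alice) = (\<lambda>_. course ?l')"
      using False by (auto simp: course_def)
    ultimately have "marching c leg x \<omega> (Suc n) (Suc N')"
      unfolding marching_def Let_def arr using N'(2) by simp
    then show ?thesis using False by auto
  qed
qed

lemma ex_marching_probing:
  "(marches (history \<omega> n) \<longrightarrow> (\<exists>N. marching c leg x \<omega> n N)) \<and> (\<exists>N. probing c leg x \<omega> n N)"
proof (induction n)
  case 0
  then show ?case using marching_0 marching_imp_probing[OF marching_0] by auto
next
  case (Suc n)
  then obtain N where "probing c leg x \<omega> n N" by blast
  from probing_step[OF this] show ?case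
    using marching_imp_probing[of c x \<omega> "Suc n"] by (auto split: if_splits)
qed

text \<open>Alice needs time \<open>y\<close> for the distance \<open>y\<close>. Bob, being slower,
  needs \<open>?z\<close>, and his delay grows linearly to \<open>gap\<close> over the whole
  leg.\<close>

lemma search_time_le_launch:
  assumes mar: "marches (history \<omega> n)" and y: "0 \<le> y" "y \<le> leg (history \<omega> n)"
    and x: "x = site leg (history \<omega> n) + orient (course (history \<omega> n)) * y"
  shows "search_time c (search_protocol leg) x \<omega> \<le>
    ennreal (launch leg (history \<omega> n) + y + gap (history \<omega> n))"
proof -
  let ?l = "history \<omega> n"
  let ?s = "launch leg ?l + leg ?l + gap ?l"
  obtain N where N: "phase leg (March ?s ?l) n (launch leg ?l) (\<lambda>_. site leg ?l) (\<lambda>_. course ?l)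
        (run c (search_protocol leg) x \<omega> N)"
      "now (run c (search_protocol leg) x \<omega> N) = launch leg ?l"
    using ex_marching_probing mar unfolding marching_def Let_def by blast
  note pos = leg[of ?l] gap_pos[of ?l]
  let ?z = "y * ((leg ?l + gap ?l) / leg ?l)"
  have z: "?z = y + gap ?l * (y / leg ?l)"
    using pos by (simp add: field_simps)
  have "gap ?l * (y / leg ?l) \<le> gap ?l"
    using pos y by (intro mult_left_le) auto
  then have z_le: "?z \<le> y + gap ?l" unfolding z by simp
  have "reach_time c (search_protocol leg) x \<omega> Alice \<le> ennreal (launch leg ?l + y)"
    by (rule phase_visits[OF N]) (use y pos x in auto)
  also have "\<dots> \<le> ennreal (launch leg ?l + y + gap ?l)"
    using pos by (intro ennreal_leI) auto
  finally have A: "reach_time c (search_protocol leg) x \<omega> Alice \<le> \<dots>" .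
  have "reach_time c (search_protocol leg) x \<omega> Bob \<le> ennreal (launch leg ?l + ?z)"
    by (rule phase_visits[OF N]) (use y pos x z_le in auto)
  also have "\<dots> \<le> ennreal (launch leg ?l + y + gap ?l)"
    using z_le by (intro ennreal_leI) auto
  finally show ?thesis
    using A by (simp add: search_time_def)
qed

end

section \<open>Fault statistics\<close>

definition weight :: "real \<Rightarrow> bool list \<Rightarrow> real" where
  "weight p l = prod_list (map (\<lambda>b. if b then p else 1 - p) l)"

lemma weight_simps [simp]:
  "weight p [] = 1"
  "weight p (b # l) = (if b then p else 1 - p) * weight p l"
  by (simp_all add: weight_def)

text \<open>This is the expectation of \<open>f (history \<omega> n)\<close>, by
  \<open>nn_integral_history\<close>.\<close>

definition mean :: "real \<Rightarrow> nat \<Rightarrow> (bool list \<Rightarrow> real) \<Rightarrow> real" where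
  "mean p n f = (\<Sum>l | length l = n. weight p l * f l)"

lemma finite_length [simp]: "finite {l :: bool list. length l = n}"
  using finite_lists_length_eq[of "UNIV :: bool set" n] by simp

lemma mean_0 [simp]: "mean p 0 f = f []"
  by (simp add: mean_def)

lemma mean_Suc:
  "mean p (Suc n) f = p * mean p n (\<lambda>l. f (True # l)) + (1 - p) * mean p n (\<lambda>l. f (False # l))"
proof -
  have eq: "{l. length l = Suc n} =
      Cons True ` {l. length l = n} \<union> Cons False ` {l. length l = n}"
    by (auto simp: length_Suc_conv)
  show ?thesis
    unfolding mean_def eq
    by (subst sum.union_disjoint)
      (auto simp: sum.reindex inj_on_def sum_distrib_left mult.assoc)
qed

lemma mean_add: "mean p n (\<lambda>l. f l + g l) = mean p n f + mean p n g"
  by (simp add: mean_def sum.distrib distrib_left)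

lemma mean_cmult: "mean p n (\<lambda>l. a * f l) = a * mean p n f"
  by (simp add: mean_def sum_distrib_left mult_ac)

lemma mean_const [simp]: "mean p n (\<lambda>_. a) = a"
  by (induction n) (auto simp: mean_Suc algebra_simps)

lemma weight_nonneg: "0 \<le> p \<Longrightarrow> p \<le> 1 \<Longrightarrow> 0 \<le> weight p l"
  by (induction l) auto

lemma mean_nonneg: "0 \<le> p \<Longrightarrow> p \<le> 1 \<Longrightarrow> (\<And>l. 0 \<le> f l) \<Longrightarrow> 0 \<le> mean p n f"
  unfolding mean_def by (intro sum_nonneg mult_nonneg_nonneg weight_nonneg) auto

interpretation coins: product_prob_space "\<lambda>_. measure_pmf (bernoulli_pmf p)" UNIV for p
  by unfold_locales

text \<open>The event is a cylinder fixing Alice's first \<open>n\<close> coins; \<open>rev\<close>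
  is due to the most recent outcome being the head.\<close>

lemma emeasure_history:
  assumes p: "0 \<le> p" "p \<le> 1" and "length l = n"
  shows "{\<omega>. history \<omega> n = l} \<in> sets (faults p)"
    and "emeasure (faults p) {\<omega>. history \<omega> n = l} = ennreal (weight p l)"
proof -
  let ?J = "(\<lambda>i. (Alice, i)) ` {..<n}"
  let ?X = "\<lambda>j. {rev l ! snd j}"
  have hist: "history \<omega> n = l \<longleftrightarrow> (\<forall>i<n. \<omega> (Alice, i) = rev l ! i)" if "length l = n" for \<omega> l n
    using that
  proof (induction n arbitrary: l)
    case (Suc n)
    then obtain b l' where l: "l = b # l'" "length l' = n" by (auto simp: length_Suc_conv)
    show ?case
      using Suc.IH[OF l(2)] l by (auto simp: nth_append less_Suc_eq)
  qed simp
  have eq: "{\<omega>. history \<omega> n = l} = prod_emb UNIV (\<lambda>_. measure_pmf (bernoulli_pmf p)) ?J (Pi\<^sub>E ?J ?X)"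
    unfolding hist[OF assms(3)] by (auto simp: prod_emb_def PiE_iff)
  show "{\<omega>. history \<omega> n = l} \<in> sets (faults p)"
    unfolding eq faults_def by (intro sets_PiM_I) auto
  have "emeasure (faults p) {\<omega>. history \<omega> n = l} =
      (\<Prod>j\<in>?J. emeasure (measure_pmf (bernoulli_pmf p)) (?X j))"
    unfolding eq faults_def by (intro coins.emeasure_PiM_emb) auto
  also have "\<dots> = (\<Prod>i<n. ennreal (if rev l ! i then p else 1 - p))"
    using p by (subst prod.reindex) (auto simp: inj_on_def emeasure_pmf_single intro!: prod.cong)
  also have "\<dots> = ennreal (\<Prod>i<n. if rev l ! i then p else 1 - p)"
    using p by (intro prod_ennreal) auto
  also have "(\<Prod>i<n. if rev l ! i then p else 1 - p) = weight p (rev l)"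
    using assms(3) unfolding weight_def
    by (subst prod.list_conv_set_nth) (auto intro!: prod.cong simp: atLeast0LessThan)
  also have "weight p (rev l) = weight p l"
    by (simp add: weight_def flip: rev_map)
  finally show "emeasure (faults p) {\<omega>. history \<omega> n = l} = ennreal (weight p l)" .
qed

lemma nn_integral_history:
  assumes p: "0 \<le> p" "p \<le> 1" and f: "\<And>l. 0 \<le> f l"
  shows "(\<lambda>\<omega>. ennreal (f (history \<omega> n))) \<in> borel_measurable (faults p)"
    and "(\<integral>\<^sup>+ \<omega>. ennreal (f (history \<omega> n)) \<partial>faults p) = ennreal (mean p n f)"
proof -
  let ?L = "{l :: bool list. length l = n}"
  have eq: "ennreal (f (history \<omega> n)) =
      (\<Sum>l\<in>?L. ennreal (f l) * indicator {\<omega>. history \<omega> n = l} \<omega>)" for \<omega>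
  proof -
    have "(\<Sum>l\<in>?L. ennreal (f l) * indicator {\<omega>. history \<omega> n = l} \<omega>) =
        (\<Sum>l\<in>?L. if l = history \<omega> n then ennreal (f l) else 0)"
      by (intro sum.cong) (auto simp: indicator_def)
    then show ?thesis by (simp add: sum.delta)
  qed
  note ms = emeasure_history[OF p]
  show "(\<lambda>\<omega>. ennreal (f (history \<omega> n))) \<in> borel_measurable (faults p)"
    unfolding eq using ms(1)
    by (intro borel_measurable_sum borel_measurable_times_ennreal borel_measurable_const
        borel_measurable_indicator) auto
  have "(\<integral>\<^sup>+ \<omega>. ennreal (f (history \<omega> n)) \<partial>faults p) =
      (\<Sum>l\<in>?L. \<integral>\<^sup>+ \<omega>. ennreal (f l) * indicator {\<omega>. history \<omega> n = l} \<omega> \<partial>faults p)"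
    unfolding eq using ms(1)
    by (intro nn_integral_sum borel_measurable_times_ennreal borel_measurable_const
        borel_measurable_indicator) auto
  also have "\<dots> = (\<Sum>l\<in>?L. ennreal (f l) * ennreal (weight p l))"
    using ms by (intro sum.cong refl) (subst nn_integral_cmult_indicator; auto)
  also have "\<dots> = (\<Sum>l\<in>?L. ennreal (weight p l * f l))"
    using f weight_nonneg[OF p] by (simp add: ennreal_mult mult.commute)
  also have "\<dots> = ennreal (mean p n f)"
    unfolding mean_def using f weight_nonneg[OF p] by (intro sum_ennreal) auto
  finally show "(\<integral>\<^sup>+ \<omega>. ennreal (f (history \<omega> n)) \<partial>faults p) = ennreal (mean p n f)" .
qed

section \<open>The expected total duration of the probes\<close>

text \<open>A failure doubles \<open>reach\<close> and a success resets it to \<open>gap\<close>.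
  Thus the partial sums satisfy \<open>S (n + 1) \<le> 2 + 2 * p * S n\<close>, and the bound is the
  fixed point of this recursion.\<close>

lemma sum_mean_reach_le:
  assumes p: "0 \<le> p" "p < 1 / 2"
  shows "(\<Sum>i<n. mean p i reach) \<le> 2 / (1 - 2 * p)"
proof (induction n)
  case 0
  then show ?case using p by simp
next
  case (Suc n)
  have gap: "mean p i (\<lambda>l. gap (False # l)) = (1 / 2) ^ Suc i" for i
  proof -
    have "mean p i (\<lambda>l. gap (False # l)) = mean p i (\<lambda>_. (1 / 2) ^ Suc i)"
      unfolding mean_def by (intro sum.cong) (auto simp: gap_def)
    then show ?thesis by simp
  qed
  have step: "mean p (Suc i) reach \<le> 2 * p * mean p i reach + (1 / 2) ^ Suc i" for i
  proof -
    have "mean p (Suc i) reach = 2 * p * mean p i reach + (1 - p) * (1 / 2) ^ Suc i"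
      using gap[of i] by (simp add: mean_Suc mean_cmult)
    moreover have "(1 - p) * (1 / 2 :: real) ^ Suc i \<le> (1 / 2) ^ Suc i"
      using p by (intro mult_left_le_one_le) auto
    ultimately show ?thesis by simp
  qed
  have geo: "(\<Sum>i<n. (1 / 2 :: real) ^ Suc i) = 1 - (1 / 2) ^ n"
    by (induction n) auto
  have "(\<Sum>i<Suc n. mean p i reach) = 1 + (\<Sum>i<n. mean p (Suc i) reach)"
    by (subst sum.lessThan_Suc_shift) (simp add: gap_def)
  also have "\<dots> \<le> 1 + (\<Sum>i<n. 2 * p * mean p i reach + (1 / 2) ^ Suc i)"
    by (intro add_left_mono sum_mono step)
  also have "\<dots> = 1 + 2 * p * (\<Sum>i<n. mean p i reach) + (1 - (1 / 2) ^ n)"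
    by (simp only: sum.distrib sum_distrib_left geo)
  also have "\<dots> \<le> 2 + 2 * p * (2 / (1 - 2 * p))"
    using mult_left_mono[OF Suc.IH, of "2 * p"] p zero_le_power[of "1 / 2 :: real" n]
    by (simp del: zero_le_power)
  also have "\<dots> = 2 / (1 - 2 * p)"
    using p by (simp add: field_simps)
  finally show ?case .
qed

text \<open>The duration of all probes of the infinite run, a single random variable that serves for
  all targets.\<close>

definition probe_time :: "(agent \<times> nat \<Rightarrow> bool) \<Rightarrow> ennreal" where
  "probe_time \<omega> = (\<Sum>i. ennreal (reach (history \<omega> i)))"

lemma probe_time_measurable:
  "0 \<le> p \<Longrightarrow> p \<le> 1 \<Longrightarrow> probe_time \<in> borel_measurable (faults p)"
  unfolding probe_time_def
  by (intro borel_measurable_suminf_order nn_integral_history) (auto intro: less_imp_le reach_pos)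

lemma nn_integral_probe_time_le:
  assumes p: "0 \<le> p" "p < 1 / 2"
  shows "(\<integral>\<^sup>+ \<omega>. probe_time \<omega> \<partial>faults p) \<le> ennreal (2 / (1 - 2 * p))"
proof -
  have p': "p \<le> 1" using p by simp
  note reach = less_imp_le[OF reach_pos]
  have "(\<integral>\<^sup>+ \<omega>. probe_time \<omega> \<partial>faults p) = (\<Sum>i. \<integral>\<^sup>+ \<omega>. ennreal (reach (history \<omega> i)) \<partial>faults p)"
    unfolding probe_time_def
    by (intro nn_integral_suminf nn_integral_history(1)[OF p(1) p' reach])
  also have "\<dots> = (\<Sum>i. ennreal (mean p i reach))"
    using nn_integral_history(2)[OF p(1) p', of reach] reach by simp
  also have "\<dots> \<le> ennreal (2 / (1 - 2 * p))"
  proof (intro suminf_le_const summableI)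
    fix n
    show "(\<Sum>i<n. ennreal (mean p i reach)) \<le> ennreal (2 / (1 - 2 * p))"
      using sum_mean_reach_le[OF p] mean_nonneg[OF p(1) p' reach]
      by (subst sum_ennreal) (auto intro: ennreal_leI)
  qed
  finally show ?thesis .
qed

lemma sum_reach_le_probe_time: "ennreal (\<Sum>i<n. reach (history \<omega> i)) \<le> probe_time \<omega>"
proof -
  have "(\<Sum>i<n. ennreal (reach (history \<omega> i))) \<le> probe_time \<omega>"
    unfolding probe_time_def by (intro sum_le_suminf summableI) auto
  then show ?thesis
    by (simp add: less_imp_le[OF reach_pos])
qed

text \<open>If all attempts failed from some point on, \<open>reach\<close> would not decrease any
  more and its sum would diverge.\<close>

lemma infinitely_many_successes:
  assumes "probe_time \<omega> < \<infinity>"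
  shows "\<exists>n. marches (history \<omega> n) \<and> successes (history \<omega> n) = j"
proof -
  have ex: "\<exists>n\<ge>m. \<not> \<omega> (Alice, n)" for m
  proof (rule ccontr)
    assume "\<not> ?thesis"
    then have T: "\<omega> (Alice, n)" if "n \<ge> m" for n using that by auto
    have const: "reach (history \<omega> m) \<le> reach (history \<omega> (m + k))" for k
    proof (induction k)
      case (Suc k)
      then show ?case using reach_pos[of "history \<omega> (m + k)"] by (simp add: T)
    qed simp
    have "of_nat k * reach (history \<omega> m) \<le> enn2real (probe_time \<omega>)" for k
    proof -
      have "of_nat k * reach (history \<omega> m) \<le> (\<Sum>i<k. reach (history \<omega> (m + i)))"
        using sum_bounded_below[of "{..<k}" "reach (history \<omega> m)" "\<lambda>i. reach (history \<omega> (m + i))"] const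
        by simp
      also have "\<dots> = (\<Sum>i\<in>{m..<m+k}. reach (history \<omega> i))"
        by (rule sum.reindex_bij_witness[of _ "\<lambda>i. i - m" "\<lambda>i. m + i"]) auto
      also have "\<dots> \<le> (\<Sum>i<m+k. reach (history \<omega> i))"
        by (intro sum_mono2) (auto intro: less_imp_le reach_pos)
      also have "\<dots> \<le> enn2real (probe_time \<omega>)"
      proof -
        have "ennreal (\<Sum>i<m+k. reach (history \<omega> i)) \<le> ennreal (enn2real (probe_time \<omega>))"
          using sum_reach_le_probe_time[of \<omega> "m + k"] assms by simp
        then show ?thesis
          by (subst (asm) ennreal_le_iff) auto
      qed
      finally show ?thesis .
    qed
    moreover obtain k :: nat where "enn2real (probe_time \<omega>) / reach (history \<omega> m) < of_nat k"
      using reals_Archimedean2 by blast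
    ultimately show False
      using reach_pos[of "history \<omega> m"] by (simp add: field_simps not_less[symmetric])
  qed
  show ?thesis
  proof (induction j)
    case 0
    then show ?case by (intro exI[of _ 0]) auto
  next
    case (Suc j)
    then obtain n where n: "successes (history \<omega> n) = j" by blast
    \<comment> \<open>The first success from index \<open>n\<close> on raises the count to
      \<open>Suc j\<close> and leaves a history after which a march starts.\<close>
    define k where "k = (LEAST k. \<not> \<omega> (Alice, n + k))"
    have "\<exists>k. \<not> \<omega> (Alice, n + k)" using ex[of n] by (metis le_Suc_ex)
    then have k: "\<not> \<omega> (Alice, n + k)" unfolding k_def by (rule LeastI_ex)
    have before: "\<omega> (Alice, n + k')" if "k' < k" for k'
      using not_less_Least[of k' "\<lambda>k. \<not> \<omega> (Alice, n + k)"] that unfolding k_def by blast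
    have "successes (history \<omega> (n + k')) = j" if "k' \<le> k" for k'
      using that by (induction k') (auto simp: n before)
    then show ?case using k by (intro exI[of _ "Suc (n + k)"]) auto
  qed
qed

section \<open>An almost uniform index from biased coins\<close>

text \<open>
  The unit interval is split in proportion \<open>p : 1 - p\<close> according to the head of \<open>l\<close>, the
  parts according to the next coin, and so on; \<open>quantile p l\<close> is the left end of the part of \<open>l\<close>.
\<close>

fun quantile :: "real \<Rightarrow> bool list \<Rightarrow> real" where
  "quantile p [] = 0"
| "quantile p (b # l) = (if b then p * quantile p l else p + (1 - p) * quantile p l)"

lemma quantile_bounds:
  assumes "0 < p" "p < 1"
  shows "0 \<le> quantile p l \<and> quantile p l < 1"
proof (induction l)
  case (Cons b l)
  have "p * quantile p l < 1"
    using mult_left_le_one_le[of "quantile p l" p] Cons assms by simp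
  moreover have "(1 - p) * quantile p l < (1 - p) * 1"
    using Cons assms by (intro mult_strict_left_mono) auto
  then have "p + (1 - p) * quantile p l < 1"
    unfolding mult_1_right less_diff_eq by (simp only: add.commute)
  ultimately show ?case using Cons assms by simp
qed simp

text \<open>Induction on the latest outcome: a threshold \<open>t \<le> p\<close> cuts only the left
  part, a larger one contains the left part and cuts the right one. The rescaled error shrinks by
  \<open>p\<close> or \<open>1 - p\<close>, hence at least by the factor
  \<open>1 - p\<close>.\<close>

lemma quantile_cdf:
  assumes p: "0 < p" "p < 1 / 2" and "0 \<le> t" "t \<le> 1"
  shows "t \<le> mean p n (\<lambda>l. of_bool (quantile p l < t)) \<and>
    mean p n (\<lambda>l. of_bool (quantile p l < t)) \<le> t + (1 - p) ^ n"
  using assms(3,4)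
proof (induction n arbitrary: t)
  case 0
  then show ?case by auto
next
  case (Suc n)
  let ?F = "\<lambda>n t. mean p n (\<lambda>l. of_bool (quantile p l < t))"
  have rec: "?F (Suc n) t = p * ?F n (t / p) + (1 - p) * ?F n ((t - p) / (1 - p))"
    using p by (simp add: mean_Suc field_simps)
  have q: "0 \<le> quantile p l" "quantile p l < 1" for l
    using quantile_bounds[of p l] p by auto
  show ?case
  proof (cases "t \<le> p")
    case True
    have "\<not> quantile p l < (t - p) / (1 - p)" for l
    proof -
      have "(t - p) / (1 - p) \<le> 0" using True p by (simp add: divide_nonpos_pos)
      then show ?thesis using q(1)[of l] by linarith
    qed
    then have F: "?F (Suc n) t = p * ?F n (t / p)"
      unfolding rec by simp
    have IH: "t / p \<le> ?F n (t / p)" "?F n (t / p) \<le> t / p + (1 - p) ^ n"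
      using Suc.IH[of "t / p"] True Suc.prems p by auto
    have "t \<le> p * ?F n (t / p)"
      using mult_left_mono[OF IH(1), of p] p by simp
    moreover have "p * ?F n (t / p) \<le> t + p * (1 - p) ^ n"
      using mult_left_mono[OF IH(2), of p] p by (simp add: distrib_left)
    moreover have "p * (1 - p) ^ n \<le> (1 - p) * (1 - p) ^ n"
      using p by (intro mult_right_mono) auto
    ultimately show ?thesis unfolding F by simp
  next
    case False
    have "quantile p l < t / p" for l
    proof -
      have "1 < t / p" using False p by simp
      then show ?thesis using q(2)[of l] by linarith
    qed
    then have F: "?F (Suc n) t = p + (1 - p) * ?F n ((t - p) / (1 - p))"
      unfolding rec by simp
    let ?s = "(t - p) / (1 - p)"
    have IH: "?s \<le> ?F n ?s" "?F n ?s \<le> ?s + (1 - p) ^ n"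
      using Suc.IH[of ?s] False Suc.prems p by auto
    have "t - p \<le> (1 - p) * ?F n ?s"
      using mult_left_mono[OF IH(1), of "1 - p"] p by simp
    moreover have "(1 - p) * ?F n ?s \<le> t - p + (1 - p) * (1 - p) ^ n"
      using mult_left_mono[OF IH(2), of "1 - p"] p by (simp add: distrib_left)
    ultimately show ?thesis unfolding F by simp
  qed
qed

definition pick :: "real \<Rightarrow> nat \<Rightarrow> bool list \<Rightarrow> nat" where
  "pick p N l = nat \<lfloor>real N * quantile p l\<rfloor>"

lemma pick_eq_iff:
  assumes "0 < p" "p < 1" "0 < N"
  shows "pick p N l = u \<longleftrightarrow> real u / real N \<le> quantile p l \<and> quantile p l < real (Suc u) / real N"
proof -
  have "0 \<le> real N * quantile p l"
    using quantile_bounds[of p l] assms by simp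
  then have "pick p N l = u \<longleftrightarrow> \<lfloor>real N * quantile p l\<rfloor> = int u"
    unfolding pick_def by (metis floor_mono floor_zero int_nat_eq nat_int)
  also have "\<dots> \<longleftrightarrow> real u \<le> real N * quantile p l \<and> real N * quantile p l < real u + 1"
    by (simp add: floor_eq_iff)
  also have "\<dots> \<longleftrightarrow> real u / real N \<le> quantile p l \<and> quantile p l < real (Suc u) / real N"
    using assms by (simp add: field_simps)
  finally show ?thesis .
qed

lemma pick_less:
  assumes "0 < p" "p < 1" "0 < N"
  shows "pick p N l < N"
proof -
  have "real (pick p N l) / real N < 1"
    using pick_eq_iff[OF assms, of l "pick p N l"] quantile_bounds[of p l] assms by linarith
  then show ?thesis using assms by simp
qed

text \<open>The probability is a difference of two values of the distribution function. Since
  \<open>quantile_cdf\<close> errs only upwards, a single error term arises.\<close>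

lemma mean_pick_le:
  assumes p: "0 < p" "p < 1 / 2" and "0 < N" "u < N"
  shows "mean p n (\<lambda>l. of_bool (pick p N l = u)) \<le> 1 / N + (1 - p) ^ n"
proof -
  let ?F = "\<lambda>t. mean p n (\<lambda>l. of_bool (quantile p l < t))"
  have p1: "p < 1" using p by simp
  have le: "real u / real N \<le> real (Suc u) / real N"
    by (simp add: divide_right_mono)
  have "(\<lambda>l. of_bool (quantile p l < real (Suc u) / real N)) =
      (\<lambda>l. of_bool (pick p N l = u) + of_bool (quantile p l < real u / real N) :: real)"
    using le unfolding pick_eq_iff[OF p(1) p1 assms(3)] fun_eq_iff of_bool_def
    by (smt (verit))
  then have "?F (real (Suc u) / real N) =
      mean p n (\<lambda>l. of_bool (pick p N l = u)) + ?F (real u / real N)"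
    by (simp add: mean_add)
  moreover have "?F (real (Suc u) / real N) \<le> real (Suc u) / real N + (1 - p) ^ n"
    using quantile_cdf[OF p, of "real (Suc u) / real N"] assms by simp
  moreover have "real u / real N \<le> ?F (real u / real N)"
    using quantile_cdf[OF p, of "real u / real N"] assms by simp
  ultimately show ?thesis
    by (simp add: add_divide_distrib)
qed

section \<open>The search\<close>

text \<open>
  \<open>radius M q r u j\<close> is the distance from the origin of the turning point at which the \<open>j\<close>-th march
  starts.  The first \<open>M\<close> marches do not depend on \<open>u\<close>, which is not known before \<open>M\<close> outcomes are.
\<close>

fun radius :: "nat \<Rightarrow> real \<Rightarrow> real \<Rightarrow> nat \<Rightarrow> nat \<Rightarrow> real" where
  "radius M q r u 0 = 0"
| "radius M q r u (Suc j) = (if j < M then 1 else q ^ u * r ^ j)"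

text \<open>A leg joins turning points on opposite sides of the origin, hence the sum of two radii.
  Dropping the front of the list leaves the \<open>M\<close> oldest outcomes.\<close>

definition route :: "real \<Rightarrow> nat \<Rightarrow> nat \<Rightarrow> real \<Rightarrow> real \<Rightarrow> bool list \<Rightarrow> real" where
  "route p M N q r l =
     (let u = pick p N (drop (length l - M) l)
      in radius M q r u (successes l) + radius M q r u (Suc (successes l)))"

lemma radius_nonneg: "0 < q \<Longrightarrow> 0 < r \<Longrightarrow> 0 \<le> radius M q r u j"
  by (cases j) auto

lemma route_pos: "0 < q \<Longrightarrow> 0 < r \<Longrightarrow> 0 < route p M N q r l"
  unfolding route_def Let_def by (intro add_nonneg_pos radius_nonneg) auto

lemma drop_history: "drop k (history \<omega> (k + n)) = history \<omega> n"
  by (induction k) auto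

lemma successes_le_length: "successes l \<le> length l"
  by (induction l) auto

text \<open>Before \<open>M\<close> outcomes are known there are fewer than \<open>M\<close>
  successes, and the two radii involved do not depend on the index.\<close>

lemma route_history:
  "route p M N q r (history \<omega> n) =
     (let u = pick p N (history \<omega> M); j = successes (history \<omega> n)
      in radius M q r u j + radius M q r u (Suc j))"
proof (cases "M \<le> n")
  case True
  then show ?thesis
    using drop_history[of "n - M" \<omega> M] by (simp add: route_def Let_def)
next
  case False
  then have "successes (history \<omega> n) < M"
    using successes_le_length[of "history \<omega> n"] by simp
  then show ?thesis
    unfolding route_def Let_def by (cases "successes (history \<omega> n)") auto
qed

text \<open>Here \<open>k\<close> counts the completed marches. Each outcome costs at most
  \<open>2 * reach\<close>: once for the probe and once for the extra \<open>gap\<close> of a march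
  before it.\<close>

lemma site_launch_history:
  fixes R :: "nat \<Rightarrow> real"
  assumes leg: "\<And>n. leg (history \<omega> n) = R (successes (history \<omega> n)) + R (Suc (successes (history \<omega> n)))"
    and R0: "R 0 = 0"
  shows "let l = history \<omega> n; j = successes l; k = (if marches l then j else Suc j) in
    site leg l = (if even j \<longleftrightarrow> marches l then - R k else R k) \<and>
    launch leg l \<le> (\<Sum>i<k. R i + R (Suc i)) + 2 * (\<Sum>i<n. reach (history \<omega> i))"
proof (induction n)
  case 0
  then show ?case using R0 by simp
next
  case (Suc n)
  let ?l = "history \<omega> n"
  have "site leg (b # ?l) = (if even (successes ?l) then 1 else - 1) * R (Suc (successes ?l))" for b
    using Suc leg[of n] by (auto simp: Let_def course_def split: if_splits)
  moreover have "launch leg (b # ?l) \<le> (\<Sum>i<Suc (successes ?l). R i + R (Suc i)) +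
      2 * (\<Sum>i<Suc n. reach (history \<omega> i))" for b
    using Suc leg[of n] reach_pos[of ?l] by (auto simp: Let_def reach_marches split: if_splits)
  ultimately show ?case
    by (auto simp: Let_def simp del: launch.simps site.simps sum.lessThan_Suc)
qed

lemma sum_power_le:
  fixes r :: real
  assumes "1 < r"
  shows "(\<Sum>i<j. r ^ i) \<le> r ^ j / (r - 1)"
  using assms by (simp add: geometric_sum divide_right_mono)

lemma sum_radius_le:
  assumes "1 \<le> q" "1 < r"
  shows "(\<Sum>i<j. radius M q r u (Suc i)) \<le> M + q ^ u * r ^ j / (r - 1)"
proof -
  have "(\<Sum>i<j. radius M q r u (Suc i)) \<le> (\<Sum>i<j. of_bool (i < M) + q ^ u * r ^ i)"
    using assms by (intro sum_mono) auto
  also have "\<dots> = (\<Sum>i<j. of_bool (i < M)) + q ^ u * (\<Sum>i<j. r ^ i)"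
    by (simp add: sum.distrib sum_distrib_left)
  also have "(\<Sum>i<j. of_bool (i < M)) \<le> real M"
  proof -
    have "(\<Sum>i<j. of_bool (i < M)) = real (card ({..<j} \<inter> {i. i < M}))"
      by (simp add: sum_of_bool_eq)
    also have "\<dots> \<le> real (card {..<M})"
      by (intro of_nat_mono card_mono) auto
    finally show ?thesis by simp
  qed
  also have "q ^ u * (\<Sum>i<j. r ^ i) \<le> q ^ u * (r ^ j / (r - 1))"
    using assms by (intro mult_left_mono sum_power_le) auto
  finally show ?thesis by simp
qed

text \<open>March \<open>j\<close> starts on the side opposite to the target and passes it after the
  distance \<open>?R j + \<bar>x\<bar>\<close>. If \<open>probe_time\<close> is infinite, the bound
  is trivial.\<close>

lemma search_time_le:
  fixes q r x :: real and M N :: nat and p :: real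
  defines "leg \<equiv> route p M N q r"
  assumes q: "1 \<le> q" and r: "1 < r" and u: "u = pick p N (history \<omega> M)"
    and x: "x = (if even j then \<bar>x\<bar> else - \<bar>x\<bar>)" and "M \<le> j" and "\<bar>x\<bar> \<le> q ^ u * r ^ j"
  shows "search_time c (search_protocol leg) x \<omega> \<le>
    ennreal (2 * M + \<bar>x\<bar> + 2 / (r - 1) * (q ^ u * r ^ j)) + 2 * probe_time \<omega>"
proof (cases "probe_time \<omega> < \<infinity>")
  case False
  then have "probe_time \<omega> = \<top>" by (metis infinity_ennreal_def top.not_eq_extremum)
  then show ?thesis by (simp add: ennreal_mult_top)
next
  case True
  then obtain n where n: "marches (history \<omega> n)" "successes (history \<omega> n) = j"
    using infinitely_many_successes by blast
  let ?R = "radius M q r u"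
  \<comment> \<open>The sum has \<open>Suc n\<close> terms; the last one absorbs Bob's delay
    \<open>gap (history \<omega> n)\<close>.\<close>
  let ?W = "\<Sum>i<Suc n. reach (history \<omega> i)"
  have pos: "0 < leg l" for l
    unfolding leg_def using q r by (intro route_pos) auto
  have leg: "leg (history \<omega> n) = ?R (successes (history \<omega> n)) + ?R (Suc (successes (history \<omega> n)))" for n
    unfolding leg_def route_history u Let_def ..
  have site: "site leg (history \<omega> n) = (if even j then - ?R j else ?R j)"
    and launch: "launch leg (history \<omega> n) \<le>
        (\<Sum>i<j. ?R i + ?R (Suc i)) + 2 * (\<Sum>i<n. reach (history \<omega> i))"
    using site_launch_history[OF leg, of n] n by (simp_all add: Let_def)
  have split: "ennreal (a + 2 * b) = ennreal a + 2 * ennreal b" if "0 \<le> a" "0 \<le> b" for a b :: real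
    using that by (simp add: ennreal_mult)
  have Rj: "0 \<le> ?R j" using q r by (intro radius_nonneg) auto
  have "search_time c (search_protocol leg) x \<omega> \<le>
      ennreal (launch leg (history \<omega> n) + (?R j + \<bar>x\<bar>) + gap (history \<omega> n))"
  proof (rule search_time_le_launch[OF pos n(1)])
    show "0 \<le> ?R j + \<bar>x\<bar>" using Rj by simp
    show "?R j + \<bar>x\<bar> \<le> leg (history \<omega> n)"
      unfolding leg n(2) using assms(6,7) by simp
    show "x = site leg (history \<omega> n) + orient (course (history \<omega> n)) * (?R j + \<bar>x\<bar>)"
      unfolding site course_def n(2) using x by (auto split: if_splits)
  qed
  also have "launch leg (history \<omega> n) + (?R j + \<bar>x\<bar>) + gap (history \<omega> n) \<le>
      2 * M + \<bar>x\<bar> + 2 / (r - 1) * (q ^ u * r ^ j) + 2 * ?W"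
  proof -
    \<comment> \<open>As \<open>?R 0 = 0\<close>, adding the start of march \<open>j\<close> makes
      every turning distance up to there count exactly twice.\<close>
    have "(\<Sum>i<j. ?R i) + ?R j = (\<Sum>i<j. ?R (Suc i))"
      using sum.lessThan_Suc_shift[of ?R j] by simp
    then have "launch leg (history \<omega> n) + ?R j \<le>
        2 * (\<Sum>i<j. ?R (Suc i)) + 2 * (\<Sum>i<n. reach (history \<omega> i))"
      using launch by (simp add: sum.distrib)
    moreover have "(\<Sum>i<j. ?R (Suc i)) \<le> M + q ^ u * r ^ j / (r - 1)"
      by (rule sum_radius_le[OF q r])
    moreover have "gap (history \<omega> n) \<le> 2 * reach (history \<omega> n)"
      using reach_marches[OF n(1)] gap_pos[of "history \<omega> n"] by simp
    ultimately show ?thesis by (simp add: field_simps)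
  qed
  also have "ennreal (2 * M + \<bar>x\<bar> + 2 / (r - 1) * (q ^ u * r ^ j) + 2 * ?W) =
      ennreal (2 * M + \<bar>x\<bar> + 2 / (r - 1) * (q ^ u * r ^ j)) + 2 * ennreal ?W"
    by (rule split) (use q r in \<open>auto intro!: add_nonneg_nonneg sum_nonneg less_imp_le[OF reach_pos]\<close>)
  also have "\<dots> \<le> ennreal (2 * M + \<bar>x\<bar> + 2 / (r - 1) * (q ^ u * r ^ j)) + 2 * probe_time \<omega>"
    by (intro add_left_mono mult_left_mono sum_reach_le_probe_time) simp
  finally show ?thesis
    by (simp add: ennreal_leI)
qed

text \<open>The bound of \<open>search_time_le\<close> is a function of the first \<open>M\<close>
  outcomes plus \<open>2 * probe_time\<close>, so the expectations add up. The first is averaged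
  over \<open>u\<close> by \<open>mean_pick_le\<close>; the integrability of
  \<open>probe_time\<close> yields almost sure finiteness.\<close>

lemma expected_time_le:
  fixes q r x :: real and M N :: nat and p :: real
  defines "leg \<equiv> route p M N q r"
  assumes p: "0 < p" "p < 1 / 2" and N: "0 < N" and q: "1 \<le> q" and r: "1 < r"
    and x: "\<And>u. u < N \<Longrightarrow> x = (if even (j u) then \<bar>x\<bar> else - \<bar>x\<bar>)"
    and M: "\<And>u. u < N \<Longrightarrow> M \<le> j u"
    and far: "\<And>u. u < N \<Longrightarrow> \<bar>x\<bar> \<le> q ^ u * r ^ j u"
  shows "expected_time c p (search_protocol leg) x \<le>
      ennreal (2 * M + 4 / (1 - 2 * p) + \<bar>x\<bar> +
        2 / (r - 1) * (1 / N + (1 - p) ^ M) * (\<Sum>u<N. q ^ u * r ^ j u))"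
    and "AE \<omega> in faults p. search_time c (search_protocol leg) x \<omega> < \<infinity>"
proof -
  let ?V = "\<lambda>u. q ^ u * r ^ j u"
  let ?f = "\<lambda>l. 2 * M + \<bar>x\<bar> + 2 / (r - 1) * ?V (pick p N l)"
  have p': "0 \<le> p" "p \<le> 1" "p < 1" using p by auto
  note less = pick_less[OF p(1) p'(3) N]
  have bound: "search_time c (search_protocol leg) x \<omega> \<le>
      ennreal (?f (history \<omega> M)) + 2 * probe_time \<omega>" for \<omega>
    unfolding leg_def using search_time_le[OF q r refl x M far] less by blast
  have V: "0 \<le> ?V u" for u using q r by simp
  have f: "0 \<le> ?f l" for l using V[of "pick p N l"] r by simp
  note meas = nn_integral_history[OF p'(1,2), where f = ?f and n = M, OF f] probe_time_measurable[OF p'(1,2)]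
  have sum: "?V (pick p N l) = (\<Sum>u<N. ?V u * of_bool (pick p N l = u))" for l
    using less[of l] by (simp add: of_bool_def sum.delta' if_distrib cong: if_cong)
  have "mean p M ?f = 2 * M + \<bar>x\<bar> + 2 / (r - 1) * (\<Sum>u<N. ?V u * mean p M (\<lambda>l. of_bool (pick p N l = u)))"
  proof -
    have "mean p M (\<lambda>l. ?V (pick p N l)) = (\<Sum>u<N. ?V u * mean p M (\<lambda>l. of_bool (pick p N l = u)))"
      unfolding sum mean_def
      by (simp only: sum_distrib_left) (subst sum.swap, simp only: mult_ac)
    then show ?thesis by (simp only: mean_add mean_cmult mean_const)
  qed
  also have "\<dots> \<le> 2 * M + \<bar>x\<bar> + 2 / (r - 1) * (\<Sum>u<N. ?V u * (1 / N + (1 - p) ^ M))"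
    using V r mean_pick_le[OF p N] by (intro add_left_mono mult_left_mono sum_mono) auto
  also have "\<dots> = 2 * M + \<bar>x\<bar> + 2 / (r - 1) * (1 / N + (1 - p) ^ M) * (\<Sum>u<N. ?V u)"
    by (simp add: sum_distrib_right[symmetric])
  finally have mean: "mean p M ?f \<le> \<dots>" .
  have "expected_time c p (search_protocol leg) x \<le>
      (\<integral>\<^sup>+ \<omega>. ennreal (?f (history \<omega> M)) + 2 * probe_time \<omega> \<partial>faults p)"
    unfolding expected_time_def by (intro nn_integral_mono bound)
  also have "\<dots> = ennreal (mean p M ?f) + 2 * (\<integral>\<^sup>+ \<omega>. probe_time \<omega> \<partial>faults p)"
    using meas by (simp add: nn_integral_add nn_integral_cmult)
  also have "\<dots> \<le> ennreal (mean p M ?f) + 2 * ennreal (2 / (1 - 2 * p))"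
    using nn_integral_probe_time_le[OF p'(1) p(2)] by (intro add_left_mono mult_left_mono) auto
  also have "\<dots> = ennreal (mean p M ?f + 4 / (1 - 2 * p))"
    using p mean_nonneg[OF p'(1,2) f] by (simp add: ennreal_mult[symmetric] ennreal_numeral[symmetric] del: ennreal_numeral flip: ennreal_plus)
  also have "\<dots> \<le> ennreal (2 * M + 4 / (1 - 2 * p) + \<bar>x\<bar> +
        2 / (r - 1) * (1 / N + (1 - p) ^ M) * (\<Sum>u<N. ?V u))"
    using mean by (intro ennreal_leI) simp
  finally show "expected_time c p (search_protocol leg) x \<le> \<dots>" .
  have "(\<integral>\<^sup>+ \<omega>. probe_time \<omega> \<partial>faults p) \<noteq> \<infinity>"
    using nn_integral_probe_time_le[OF p'(1) p(2)] by (auto simp: top_unique)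
  then have "AE \<omega> in faults p. probe_time \<omega> \<noteq> \<infinity>"
    by (intro nn_integral_PInf_AE probe_time_measurable p'(1,2))
  then show "AE \<omega> in faults p. search_time c (search_protocol leg) x \<omega> < \<infinity>"
  proof (rule AE_mp, intro AE_I2 impI)
    fix \<omega> assume "probe_time \<omega> \<noteq> \<infinity>"
    then have "ennreal (?f (history \<omega> M)) + 2 * probe_time \<omega> < \<infinity>"
      by (simp add: ennreal_mult_less_top less_top)
    then show "search_time c (search_protocol leg) x \<omega> < \<infinity>"
      by (rule le_less_trans[OF bound])
  qed
qed

section \<open>Choice of the march that finds the target\<close>

text \<open>Marches towards the side of \<open>x\<close> have the parity \<open>s\<close>, and by
  \<open>q ^ N = r\<^sup>2\<close> their end points are at the distances
  \<open>r ^ s * q ^ (N * i + u)\<close>. The first ones beyond the target form a geometric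
  progression as \<open>u\<close> varies.\<close>

lemma exists_turns:
  fixes q r x :: real
  assumes N: "0 < N" and q: "1 < q" and r: "1 < r" "q ^ N = r\<^sup>2"
    and x: "r * q ^ (N * Suc M) < \<bar>x\<bar>"
  shows "\<exists>j. (\<forall>u<N. x = (if even (j u) then \<bar>x\<bar> else - \<bar>x\<bar>) \<and> M \<le> j u \<and> \<bar>x\<bar> \<le> q ^ u * r ^ j u) \<and>
    (\<Sum>u<N. q ^ u * r ^ j u) \<le> q * \<bar>x\<bar> * (r\<^sup>2 - 1) / (q - 1)"
proof -
  define s :: nat where "s = (if 0 \<le> x then 0 else 1)"
  have rs: "1 \<le> r ^ s" "r ^ s \<le> r" using r by (auto simp: s_def)
  define m where "m = (LEAST m. \<bar>x\<bar> \<le> r ^ s * q ^ m)"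
  obtain m' where "\<bar>x\<bar> < q ^ m'" using real_arch_pow[OF q] by blast
  also have "\<dots> \<le> r ^ s * q ^ m'" using rs q by simp
  finally have "\<exists>m. \<bar>x\<bar> \<le> r ^ s * q ^ m" by (intro exI[of _ m']) simp
  then have m: "\<bar>x\<bar> \<le> r ^ s * q ^ m" unfolding m_def by (rule LeastI_ex)
  \<comment> \<open>This places the marches chosen below after the first \<open>M\<close>, and makes
    \<open>m\<close> positive, so that its minimality can be used at \<open>m - 1\<close>.\<close>
  have big: "N * Suc M < m"
  proof (rule ccontr)
    assume "\<not> ?thesis"
    then have "r ^ s * q ^ m \<le> r * q ^ (N * Suc M)"
      using rs q by (intro mult_mono power_increasing) auto
    then show False using m x by simp
  qed
  then have "\<not> \<bar>x\<bar> \<le> r ^ s * q ^ (m - 1)"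
    unfolding m_def by (intro not_less_Least) simp
  moreover have "q ^ m = q * q ^ (m - 1)"
    using big by (cases m) auto
  ultimately have m_le: "r ^ s * q ^ m \<le> q * \<bar>x\<bar>"
    using q by simp
  \<comment> \<open>The ceiling of \<open>(m - u) / N\<close>, that is, the least \<open>i\<close>
    with \<open>m \<le> N * i + u\<close>.\<close>
  define i where "i u = (m + N - 1 - u) div N" for u
  have iu: "m \<le> N * i u + u" "N * i u + u < m + N" if "u < N" for u
  proof -
    have "m + N - 1 - u = N * i u + (m + N - 1 - u) mod N"
      unfolding i_def by simp
    moreover have "(m + N - 1 - u) mod N < N" using N by simp
    ultimately show "m \<le> N * i u + u" "N * i u + u < m + N" using that big by linarith+
  qed
  define j where "j u = 2 * i u + s" for u
  have pow: "q ^ u * r ^ j u = r ^ s * q ^ (N * i u + u)" for u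
    unfolding j_def power_add power_mult r(2) by (simp only: mult_ac)
  have "M \<le> j u" if "u < N" for u
  proof -
    have "N * M < N * i u"
      using iu(1)[OF that] big that unfolding mult_Suc_right by linarith
    then show ?thesis by (simp add: j_def)
  qed
  moreover have "\<bar>x\<bar> \<le> q ^ u * r ^ j u" if "u < N" for u
  proof -
    have "r ^ s * q ^ m \<le> r ^ s * q ^ (N * i u + u)"
      using iu(1)[OF that] q rs by (intro mult_left_mono power_increasing) auto
    then show ?thesis using m unfolding pow by simp
  qed
  moreover have "x = (if even (j u) then \<bar>x\<bar> else - \<bar>x\<bar>)" for u
    by (simp add: j_def s_def)
  moreover have "(\<Sum>u<N. q ^ u * r ^ j u) \<le> q * \<bar>x\<bar> * (r\<^sup>2 - 1) / (q - 1)"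
  proof -
    \<comment> \<open>The exponents are distinct modulo \<open>N\<close> and lie in a window of
      length \<open>N\<close> starting at \<open>m\<close>.\<close>
    have inj: "inj_on (\<lambda>u. N * i u + u) {..<N}"
    proof (rule inj_onI)
      fix u v assume "u \<in> {..<N}" "v \<in> {..<N}" "N * i u + u = N * i v + v"
      then have "(N * i u + u) mod N = (N * i v + v) mod N" "u < N" "v < N" by auto
      then show "u = v" by simp
    qed
    have "(\<Sum>u<N. q ^ (N * i u + u)) = (\<Sum>k\<in>(\<lambda>u. N * i u + u) ` {..<N}. q ^ k)"
      by (simp add: sum.reindex[OF inj])
    also have "\<dots> \<le> (\<Sum>k\<in>{m..<m + N}. q ^ k)"
      using iu q by (intro sum_mono2) auto
    also have "\<dots> = (\<Sum>k<N. q ^ (m + k))"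
      by (rule sum.reindex_bij_witness[of _ "\<lambda>k. m + k" "\<lambda>k. k - m"]) auto
    also have "\<dots> = q ^ m * ((r\<^sup>2 - 1) / (q - 1))"
      using q by (simp add: power_add geometric_sum r(2) flip: sum_distrib_left)
    finally have "r ^ s * (\<Sum>u<N. q ^ (N * i u + u)) \<le> r ^ s * (q ^ m * ((r\<^sup>2 - 1) / (q - 1)))"
      using rs by (intro mult_left_mono) auto
    also have "\<dots> \<le> q * \<bar>x\<bar> * ((r\<^sup>2 - 1) / (q - 1))"
      unfolding mult.assoc[symmetric] using m_le r q
      by (intro mult_right_mono) (auto intro!: divide_nonneg_nonneg)
    finally show ?thesis unfolding pow by (simp add: sum_distrib_left)
  qed
  ultimately show ?thesis by blast
qed

section \<open>The competitive ratio\<close>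

lemma Lambert_W_inverse_exp_1:
  "ln (1 / Lambert_W (1 / exp 1)) = 1 + Lambert_W (1 / exp 1)"
  "\<bar>(1 + 1 / Lambert_W (1 / exp 1)) - 4.59112\<bar> \<le> 0.000005"
proof -
  let ?f = "\<lambda>w::real. w * exp w"
  let ?a = "1 / 3.591125 :: real" and ?b = "1 / 3.591115 :: real"
  have mono: "?f u < ?f v" if "- 1 \<le> u" "u < v" for u v
  proof (rule DERIV_pos_imp_increasing_open[OF that(2)])
    fix x assume "u < x" "x < v"
    then have "0 < (1 + x) * exp x"
      using that(1) by (intro mult_pos_pos) auto
    moreover have "DERIV ?f x :> (1 + x) * exp x"
      by (auto intro!: derivative_eq_intros simp: algebra_simps)
    ultimately show "\<exists>y. DERIV ?f x :> y \<and> y > 0"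
      by blast
  qed (auto intro!: continuous_intros)
  \<comment> \<open>Taylor's formula with remainder; 1.3 exceeds \<open>?a + 1\<close> and
    \<open>?b + 1\<close>, and 5 bounds \<open>exp\<close> up to 1.3.\<close>
  have exp_bounds: "exp x \<le> (\<Sum>m<13. x ^ m / fact m) + 5 * x ^ 13 / fact 13"
       "exp x \<ge> (\<Sum>m<13. x ^ m / fact m)" if "0 \<le> x" "x \<le> 1.3" for x :: real
  proof -
    obtain t where t: "\<bar>t\<bar> \<le> \<bar>x\<bar>" "exp x = (\<Sum>m<13. x ^ m / fact m) + exp t / fact 13 * x ^ 13"
      using Maclaurin_exp_le[of x 13] by blast
    show "exp x \<ge> (\<Sum>m<13. x ^ m / fact m)" using t that by simp
    have "exp t \<le> exp (1.3 :: real)" using t that by simp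
    also have "\<dots> = exp (0.65::real) * exp 0.65" by (simp flip: exp_add)
    also have "\<dots> \<le> (1 + 0.65 + 0.65\<^sup>2) * (1 + 0.65 + 0.65\<^sup>2)"
      by (intro mult_mono exp_bound) auto
    also have "\<dots> \<le> 5"
      by (simp add: power2_eq_square)
    finally have "exp t / fact 13 * x ^ 13 \<le> 5 / fact 13 * x ^ 13"
      using that by (intro mult_right_mono divide_right_mono) auto
    then show "exp x \<le> (\<Sum>m<13. x ^ m / fact m) + 5 * x ^ 13 / fact 13"
      using t by simp
  qed
  have mult: "exp (a + 1) = exp 1 * exp a" for a :: real
    by (simp add: exp_add)
  \<comment> \<open>The comparison of \<open>w * exp w\<close> with \<open>1 / exp 1\<close> is that
    of \<open>exp (w + 1)\<close> with \<open>1 / w\<close>.\<close>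
  have lower: "?f ?a \<le> 1 / exp 1"
  proof -
    have "exp (?a + 1) \<le> 3.591125"
      by (rule order.trans[OF exp_bounds(1)])
        (simp_all add: eval_nat_numeral fact_numeral lessThan_Suc)
    then show ?thesis unfolding mult by (simp add: field_simps)
  qed
  have upper: "1 / exp 1 \<le> ?f ?b"
  proof -
    have "exp (?b + 1) \<ge> 3.591115"
      by (rule order.trans[OF _ exp_bounds(2)])
        (simp_all add: eval_nat_numeral fact_numeral lessThan_Suc)
    then show ?thesis unfolding mult by (simp add: field_simps)
  qed
  have cont: "continuous_on {?a..?b} ?f"
    by (intro continuous_intros)
  have "?a \<le> ?b"
    by simp
  then obtain w where w: "?a \<le> w" "w \<le> ?b" "?f w = 1 / exp 1"
    using IVT'[OF lower upper _ cont] by blast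
  have W: "Lambert_W (1 / exp 1) = w"
    unfolding Lambert_W_def
  proof (rule the_equality)
    show "- 1 \<le> w \<and> w * exp w = 1 / exp 1" using w by simp
  next
    fix v :: real assume "- 1 \<le> v \<and> v * exp v = 1 / exp 1"
    then show "v = w" using mono[of v w] mono[of w v] w by (cases v w rule: linorder_cases) auto
  qed
  have "0 < w" using w(1) by (rule less_le_trans[rotated]) simp
  have "1 / w = exp (1 + w)" using w(3) \<open>0 < w\<close> by (simp add: exp_add field_simps)
  then show "ln (1 / Lambert_W (1 / exp 1)) = 1 + Lambert_W (1 / exp 1)" by (simp add: W)
  have "1 / w \<le> 3.591125" "1 / w \<ge> 3.591115"
    using w \<open>0 < w\<close> by (simp_all add: field_simps)
  then show "\<bar>(1 + 1 / Lambert_W (1 / exp 1)) - 4.59112\<bar> \<le> 0.000005"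
    unfolding W abs_le_iff by simp
qed

text \<open>The equation for \<open>ln r\<close> is the critical point condition of
  \<open>(r + 1) / ln r\<close>, whose value there is \<open>r\<close>. Comparing
  \<open>2 * ln r = N * ln q\<close> with \<open>N * (q - 1)\<close> passes from the discrete phase
  to this value.\<close>

lemma ratio_coefficient_le:
  fixes q r h :: real
  assumes N: "0 < N" and q: "1 < q" and r: "1 < r" "q ^ N = r\<^sup>2" and ln_r: "ln r = 1 + 1 / r"
    and "0 \<le> h"
  shows "2 / (r - 1) * (1 / N + h) * (q * (r\<^sup>2 - 1) / (q - 1)) \<le> r * q * (1 + N * h)"
proof -
  have "2 * (r + 1) / r = 2 * ln r"
    using r ln_r by (simp add: field_simps)
  also have "\<dots> = ln (q ^ N)"
    using r by (simp add: ln_realpow)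
  also have "\<dots> = N * ln q"
    using q by (simp add: ln_realpow)
  also have "\<dots> \<le> N * (q - 1)"
    using q ln_le_minus_one[of q] by (intro mult_left_mono) auto
  finally have le: "2 * (r + 1) \<le> r * (N * (q - 1))"
    using r by (simp add: field_simps)
  have "2 / (r - 1) * (1 / N + h) * (q * (r\<^sup>2 - 1) / (q - 1)) =
      q * (1 + N * h) * (2 * (r + 1) / (N * (q - 1)))"
  proof -
    have "r\<^sup>2 - 1 = (r - 1) * (r + 1)" by (simp add: power2_eq_square algebra_simps)
    moreover have "1 / N + h = (1 + N * h) / N" using N by (simp add: field_simps)
    ultimately show ?thesis using r q N by (simp add: mult_ac) (simp add: algebra_simps)
  qed
  also have "\<dots> \<le> q * (1 + N * h) * r"
    using le q N assms(6) by (intro mult_left_mono) (auto simp: field_simps)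
  finally show ?thesis by (simp add: mult_ac)
qed

text \<open>For mere finiteness one late march \<open>j\<close> of the right parity serves all
  indices \<open>u\<close>, also for targets near the origin.\<close>

lemma solves_search_route:
  fixes q r :: real
  assumes p: "0 < p" "p < 1 / 2" and N: "0 < N" and q: "1 \<le> q" and r: "1 < r"
  shows "solves_search c p (search_protocol (route p M N q r))"
  unfolding solves_search_def
proof (intro conjI allI)
  show "admissible (search_protocol (route p M N q r))"
    using q r by (intro admissible_search_protocol route_pos) auto
next
  fix x :: real
  obtain k where k: "\<bar>x\<bar> < r ^ k" using real_arch_pow[OF r] by blast
  define j where "j = 2 * (k + M) + (if 0 \<le> x then 0 else 1)"
  have "r ^ k \<le> r ^ j" using r by (intro power_increasing) (auto simp: j_def)
  moreover have "r ^ j \<le> q ^ u * r ^ j" for u using q r by simp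
  ultimately have far: "\<bar>x\<bar> \<le> q ^ u * r ^ j" for u
    using k by (meson less_imp_le order.trans)
  show "AE \<omega> in faults p. search_time c (search_protocol (route p M N q r)) x \<omega> < \<infinity>"
    by (rule expected_time_le(2)[OF p N q r, where j = "\<lambda>_. j"]) (simp add: j_def, simp add: j_def, rule far)
qed

lemma competitive_ratio_le:
  fixes b C \<epsilon> :: real
  assumes "\<And>x. X < \<bar>x\<bar> \<Longrightarrow> expected_time c p P x \<le> ennreal (C + b * \<bar>x\<bar>)" and "0 < \<epsilon>" "0 \<le> C" "0 \<le> b"
  shows "competitive_ratio c p P \<le> ennreal (b + \<epsilon>)"
  unfolding competitive_ratio_def
proof (rule Limsup_bounded)
  show "\<forall>\<^sub>F x in at_infinity. expected_time c p P x / ennreal \<bar>x\<bar> \<le> ennreal (b + \<epsilon>)"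
    unfolding eventually_at_infinity
  proof (intro exI allI impI)
    fix x :: real assume "\<bar>X\<bar> + C / \<epsilon> + 1 \<le> norm x"
    moreover have "0 \<le> C / \<epsilon>" using assms by simp
    ultimately have x: "X < \<bar>x\<bar>" "0 < \<bar>x\<bar>" "C / \<epsilon> \<le> \<bar>x\<bar>" by auto
    have "expected_time c p P x / ennreal \<bar>x\<bar> \<le> ennreal (C + b * \<bar>x\<bar>) / ennreal \<bar>x\<bar>"
      by (intro divide_right_mono_ennreal assms x)
    also have "\<dots> = ennreal ((C + b * \<bar>x\<bar>) / \<bar>x\<bar>)"
      using x assms by (intro divide_ennreal) auto
    also have "\<dots> \<le> ennreal (b + \<epsilon>)"
      using x assms by (intro ennreal_leI) (simp add: field_simps)
    finally show "expected_time c p P x / ennreal \<bar>x\<bar> \<le> ennreal (b + \<epsilon>)" .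
  qed
qed

text \<open>The \<open>N\<close>-th roots of \<open>r\<^sup>2\<close> tend to 1.\<close>

lemma exists_fine_scale:
  fixes r h :: real
  assumes r: "1 < r" and h: "0 < h"
  shows "\<exists>N q. 0 < N \<and> 1 < q \<and> q \<le> 1 + h \<and> q ^ N = r\<^sup>2"
proof -
  have "(\<lambda>n. root n (r\<^sup>2)) \<longlonglongrightarrow> 1"
    using r by (intro LIMSEQ_root_const) auto
  then have "\<forall>\<^sub>F n in sequentially. root n (r\<^sup>2) < 1 + h"
    by (rule order_tendstoD) (use h in simp)
  then obtain n where n: "\<And>k. n \<le> k \<Longrightarrow> root k (r\<^sup>2) < 1 + h"
    unfolding eventually_sequentially by blast
  have "1 < root (Suc n) (r\<^sup>2)"
    using r by simp
  then show ?thesis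
    using n[of "Suc n"] r by (intro exI[of _ "Suc n"] exI[of _ "root (Suc n) (r\<^sup>2)"]) (simp del: power_Suc)
qed

theorem theorem5:
  fixes c :: communication and p \<epsilon> :: real
  assumes "0 < p" and "p < 1 / 2" and "0 < \<epsilon>"
  shows "\<bar>(1 + 1 / Lambert_W (1 / exp 1)) - 4.59112\<bar> \<le> 0.000005 \<and>
    (\<exists>P. solves_search c p P \<and>
         competitive_ratio c p P \<le> ennreal (1 + 1 / Lambert_W (1 / exp 1) + \<epsilon>))"
proof -
  note p = assms(1,2)
  define r where "r = 1 / Lambert_W (1 / exp 1)"
  have near: "\<bar>(1 + r) - 4.59112\<bar> \<le> 0.000005"
    using Lambert_W_inverse_exp_1(2) by (simp only: r_def)
  then have r: "1 < r" unfolding abs_le_iff by simp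
  have ln_r: "ln r = 1 + 1 / r"
    using Lambert_W_inverse_exp_1(1) by (simp add: r_def)
  \<comment> \<open>Both relative errors, of \<open>q\<close> and of the index distribution, are at
    most \<open>h\<close>, and \<open>(1 + h) * (1 + h) \<le> 1 + 3 * h\<close>. This costs at most
    \<open>\<epsilon> / 2\<close>; the other half absorbs the additive constant
    \<open>?C\<close>.\<close>
  define h where "h = min 1 (\<epsilon> / (6 * r))"
  have h: "0 < h" "h \<le> 1" "h \<le> \<epsilon> / (6 * r)"
    using assms(3) r by (auto simp: h_def)
  obtain N q where N: "0 < N" and q: "1 < q" "q \<le> 1 + h" "q ^ N = r\<^sup>2"
    using exists_fine_scale[OF r h(1)] by blast
  \<comment> \<open>\<open>M\<close> is chosen after \<open>N\<close>, since the bias of a single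
    index must be small compared with \<open>1 / N\<close>.\<close>
  obtain M where "(1 - p) ^ M < h / N"
    using real_arch_pow_inv[of "h / N" "1 - p"] h N p by auto
  then have M: "N * (1 - p) ^ M \<le> h"
    using N by (simp add: field_simps)
  let ?P = "search_protocol (route p M N q r)"
  let ?b = "1 + r * q * (1 + N * (1 - p) ^ M)"
  let ?C = "2 * M + 4 / (1 - 2 * p)"
  have "expected_time c p ?P x \<le> ennreal (?C + ?b * \<bar>x\<bar>)" if x: "r * q ^ (N * Suc M) < \<bar>x\<bar>" for x
  proof -
    obtain j where j: "\<And>u. u < N \<Longrightarrow> x = (if even (j u) then \<bar>x\<bar> else - \<bar>x\<bar>)"
        "\<And>u. u < N \<Longrightarrow> M \<le> j u" "\<And>u. u < N \<Longrightarrow> \<bar>x\<bar> \<le> q ^ u * r ^ j u"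
      and sum: "(\<Sum>u<N. q ^ u * r ^ j u) \<le> q * \<bar>x\<bar> * (r\<^sup>2 - 1) / (q - 1)"
      using exists_turns[OF N q(1) r q(3) x] by blast
    let ?k = "2 / (r - 1) * (1 / N + (1 - p) ^ M)"
    have "expected_time c p ?P x \<le> ennreal (?C + \<bar>x\<bar> + ?k * (\<Sum>u<N. q ^ u * r ^ j u))"
      by (rule expected_time_le(1)[OF p N less_imp_le[OF q(1)] r j])
    also have "\<dots> \<le> ennreal (?C + ?b * \<bar>x\<bar>)"
    proof (rule ennreal_leI)
      have "?k * (\<Sum>u<N. q ^ u * r ^ j u) \<le> ?k * (q * \<bar>x\<bar> * (r\<^sup>2 - 1) / (q - 1))"
        using sum r p by (intro mult_left_mono) auto
      also have "\<dots> = ?k * (q * (r\<^sup>2 - 1) / (q - 1)) * \<bar>x\<bar>"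
        by simp
      also have "\<dots> \<le> r * q * (1 + N * (1 - p) ^ M) * \<bar>x\<bar>"
        using p by (intro mult_right_mono ratio_coefficient_le N q(1) r q(3) ln_r) auto
      finally show "?C + \<bar>x\<bar> + ?k * (\<Sum>u<N. q ^ u * r ^ j u) \<le> ?C + ?b * \<bar>x\<bar>"
        by (simp add: distrib_right)
    qed
    finally show ?thesis .
  qed
  then have "competitive_ratio c p ?P \<le> ennreal (?b + \<epsilon> / 2)"
    by (rule competitive_ratio_le) (use p r q assms(3) in auto)
  also have "?b + \<epsilon> / 2 \<le> 1 + r + \<epsilon>"
  proof -
    have "q * (1 + N * (1 - p) ^ M) \<le> (1 + h) * (1 + h)"
      using q M h p by (intro mult_mono) auto
    also have "\<dots> = 1 + 2 * h + h * h"
      by (simp add: algebra_simps)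
    also have "\<dots> \<le> 1 + 3 * h"
      using h mult_left_le[of h h] by simp
    finally have "r * (q * (1 + N * (1 - p) ^ M)) \<le> r * (1 + 3 * h)"
      using r by (intro mult_left_mono) auto
    also have "\<dots> \<le> r + \<epsilon> / 2"
      using h(3) r by (simp add: field_simps)
    finally show ?thesis by (simp add: mult.assoc)
  qed
  finally have "competitive_ratio c p ?P \<le> ennreal (1 + r + \<epsilon>)"
    by (simp add: ennreal_leI)
  moreover have "solves_search c p ?P"
    by (rule solves_search_route[OF p N less_imp_le[OF q(1)] r])
  ultimately show ?thesis
    using near unfolding r_def by blast
qed

end
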